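(* Under the assumption that, for all $n=1,2,\ldots$ and all $a_1,\ldots,a_n\in\alpha$, the limit $$\mathsf S_{a_1,\ldots,a_n} := \lim_{\ell\to\infty} \ell^{n-1}\langle\!\langle q_{a_1},\cdots , q_{a_n}\rangle\!\rangle^{\rm c}_\ell$$ exists, the following holds for every $n=1,2,\ldots$ and all $o_1,\ldots,o_n,o\in\mathcal A$: the limits $$\mathsf S_{o_1,\ldots,o_n} := \lim_{\ell\to\infty} \ell^{n-1}\langle\!\langle \mathsf o_1(\underline q),\cdots ,\mathsf o_n(\underline q)\rangle\!\rangle^{\rm c}_\ell,\qquad \langle\!\langle \mathsf o(\underline q)\rangle\!\rangle := \lim_{\ell\to\infty} \langle\!\langle \mathsf o(\underline q)\rangle\!\rangle_\ell$$ exist; we have $$\langle\!\langle \mathsf o(\underline q)\rangle\!\rangle = \mathsf o(\langle\!\langle \underline q\rangle\!\rangle);$$ and, for all $n\geq 2$, $$\mathsf S_{o_1,\ldots,o_n}= \sum_{\Upsilon\in C^{\rm min}(n)}\ \sum_{a_k^V\in \alpha\,:\,k\in V,V\in\Upsilon} \Bigg(\prod_{\{k_1,\ldots,k_{|V|}\}=V\in\Upsilon} \mathsf S_{a^V_{k_1},\ldots,a^V_{k_{|V|}}}\Bigg)\times\Bigg(\prod_{k=1}^n \frac{\partial^{m_\Upsilon(k)}\mathsf o_k(\underline{\mathsf q})}{\prod_{V\in\Upsilon_k}\partial \mathsf q_{a^V_k}}\Bigg|_{\underline{\mathsf q} = \langle\!\langle \underline{q}\rangle\!\rangle}\Bigg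).$$
   Context: Let $\alpha$ be a set and $\mathcal A$ a unital, commutative, associative algebra over $\mathbb F=\mathbb R$ or $\mathbb C$ generated by $\{\mathbf 1, q_a : a\in\alpha\}$. Write $\underline q=(q_a:a\in\alpha)$; every element $o\in\mathcal A$ is a polynomial $o=\mathsf o(\underline q)=c\mathbf 1+\sum_{n\ge1}\sum_{a_1,\ldots,a_n\in\alpha}c^{a_1,\ldots,a_n}q_{a_1}\cdots q_{a_n}$ with finitely many nonzero coefficients. Let $\langle\!\langle\cdot\rangle\!\rangle_\ell:\mathcal A\to\mathbb F$, $\ell>0$, be a family of linear maps normalised by $\langle\!\langle\mathbf 1\rangle\!\rangle_\ell=1$, and define the cumulants $\langle\!\langle\cdot,\ldots,\cdot\rangle\!\rangle^{\rm c}_\ell$ via the moment–cumulant formula $\langle\!\langle o_1\cdots o_n\rangle\!\rangle_\ell=\sum_{\Pi\in P(n)}\prod_{V=(j_1,\ldots,j_{|V|})\in\Pi}\langle\!\langle o_{j_1},\ldots,o_{j_{|V|}}\rangle\!\rangle^{\rm c}_\ell$, with $P(n)$ the set of partitions of $\{1,\ldots,n\}$. A connected cover of $\{1,\ldots,n\}$ is a set $\Upsilon$ of patches $V\subseteq\{1,\ldots,n\}$ whose union is $\{1,\ldots,n\}$ and such that no subset of patches has union disjoint from the union of the complementary patches. Its index is $\iota(\Upsilon)=\sum_{V\in\Upsilon}|V|-|\Upsilon|$ (minimal value $n-1$). $C^{\rm min}(n)$ is the set of connected covers with $\iota(\Upsilon)=n-1$ and $|V|\ge2$ for all $V\in\Upsilon$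 (minimal connected covers). For $k\in\{1,\ldots,n\}$, $\Upsilon_k=\{V\in\Upsilon:k\in V\}$ and $m_\Upsilon(k)=|\Upsilon_k|$. For each $V\in\Upsilon$ and $k\in V$, $a^V_k\in\alpha$ is an independent summation index. $\langle\!\langle\underline q\rangle\!\rangle=(\lim_{\ell\to\infty}\langle\!\langle q_a\rangle\!\rangle_\ell: a\in\alpha)$. *)

theory Defs
  imports "HOL-Analysis.Analysis" "HOL-Library.Multiset" "HOL-Library.Disjoint_Sets"
begin

text \<open>Polynomials in the commuting variables q_a (a :: 'a) with coefficients in 'f:
  coefficient functions on monomials (multisets of variables) with finite support.\<close>

definition fin_poly :: "('a multiset \<Rightarrow> 'f::zero) \<Rightarrow> bool" where
  "fin_poly c \<longleftrightarrow> finite {m. c m \<noteq> 0}"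

definition evalF :: "('a multiset \<Rightarrow> 'f::comm_ring_1) \<Rightarrow> ('a \<Rightarrow> 'f) \<Rightarrow> 'f" where
  "evalF c x = (\<Sum>m\<in>{m. c m \<noteq> 0}. c m * prod_mset (image_mset x m))"

definition evalA :: "('f \<Rightarrow> 'b \<Rightarrow> 'b) \<Rightarrow> ('a \<Rightarrow> 'b::comm_ring_1) \<Rightarrow> ('a multiset \<Rightarrow> 'f::zero) \<Rightarrow> 'b" where
  "evalA sm q c = (\<Sum>m\<in>{m. c m \<noteq> 0}. sm (c m) (prod_mset (image_mset q m)))"

text \<open>Mixed partial derivative with respect to the multiset D of variables:
  the derivative of the monomial x^(m+D) w.r.t. D is prod_a (m_a+1)...(m_a+D_a) x^m.\<close>
definition pderivs :: "'a multiset \<Rightarrow> ('a multiset \<Rightarrow> 'f::comm_ring_1) \<Rightarrow> ('a multiset \<Rightarrow> 'f)" where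
  "pderivs D c = (\<lambda>m. (\<Prod>a\<in>set_mset D. pochhammer (of_nat (count m a + 1)) (count D a)) * c (m + D))"

definition F_algebra :: "('f::field \<Rightarrow> 'b::comm_ring_1 \<Rightarrow> 'b) \<Rightarrow> bool" where
  "F_algebra sm \<longleftrightarrow>
     (\<forall>a x y. sm a (x + y) = sm a x + sm a y) \<and>
     (\<forall>a b x. sm (a + b) x = sm a x + sm b x) \<and>
     (\<forall>a b x. sm (a * b) x = sm a (sm b x)) \<and>
     (\<forall>x. sm 1 x = x) \<and>
     (\<forall>a x y. sm a (x * y) = sm a x * y)"

text \<open>Set partitions P(n) of {0..<n} (indices shifted to start at 0).\<close>
definition set_partitions :: "nat \<Rightarrow> nat set set set" where
  "set_partitions n = {P. partition_on {0..<n} P}"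

definition connected_cover :: "nat \<Rightarrow> nat set set \<Rightarrow> bool" where
  "connected_cover n U \<longleftrightarrow>
     (\<forall>V\<in>U. V \<subseteq> {0..<n}) \<and> \<Union>U = {0..<n} \<and>
     (\<forall>W. W \<subseteq> U \<and> W \<noteq> {} \<and> W \<noteq> U \<longrightarrow> \<Union>W \<inter> \<Union>(U - W) \<noteq> {})"

definition cover_index :: "nat set set \<Rightarrow> int" where
  "cover_index U = (\<Sum>V\<in>U. int (card V)) - int (card U)"

definition Cmin :: "nat \<Rightarrow> nat set set set" where
  "Cmin n = {U. connected_cover n U \<and> cover_index U = int n - 1 \<and> (\<forall>V\<in>U. 2 \<le> card V)}"

definition Slim :: "(real \<Rightarrow> 'b list \<Rightarrow> 'f::real_normed_field) \<Rightarrow> 'b list \<Rightarrow> 'f" where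
  "Slim \<kappa> os = Lim at_top (\<lambda>l. of_real l ^ (length os - 1) * \<kappa> l os)"

end

theory Submission
  imports Defs
begin

text \<open>
  The cumulant of a product obeys
  \<open>\<kappa>(o\<^sub>1,\<dots>,o\<^sub>n\<^sub>-\<^sub>1,xy) = \<kappa>(o\<^sub>1,\<dots>,o\<^sub>n\<^sub>-\<^sub>1,x,y) + \<Sum>\<^sub>R \<kappa>(o\<^sub>R,x) \<kappa>(o\<^sub>R\<^sub>',y)\<close>,
  where \<open>R\<close> runs over the subsets of \<open>{1,\<dots>,n-1}\<close> and \<open>R'\<close> is the complement of \<open>R\<close>. After
  multiplication by \<open>\<ell>\<^sup>n\<^sup>-\<^sup>1\<close> the first term is of order \<open>1/\<ell>\<close>, so peeling generators off monomials
  one at a time gives existence of all limits and the recursion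
  \<open>S(o\<^sub>1,\<dots>,o\<^sub>n\<^sub>-\<^sub>1,xy) = \<Sum>\<^sub>R S(o\<^sub>R,x) S(o\<^sub>R\<^sub>',y)\<close>.
  The sum over minimal connected covers obeys the same recursion: these covers are the hypertrees,
  the Leibniz rule distributes the patches at vertex \<open>n\<close> over \<open>x\<close> and \<open>y\<close>, and splitting that
  vertex accordingly cuts the hypertree into one on \<open>R \<union> {n}\<close> and one on \<open>R' \<union> {n}\<close>. Both sides
  also agree on generators, where only the cover by a single patch survives.
\<close>

section \<open>Cumulants\<close>

text \<open>The cumulants are given only implicitly, by the moment formula. Singling out the block
  that contains a fixed index turns this formula into a triangular linear system with unit diagonal
  and moments on the right. Hence the cumulants are unique, and multilinearity, symmetry and the
  product rule can all be checked on moments.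

  The product rule is also what makes the induction delicate: its first term has one more argument
  and the same total degree, so neither the number of arguments nor the degree decreases. The sum of
  the squared degrees does.

  In the recursion for a generator \<open>x\<close>, the term with empty \<open>R\<close> is the
  mean of \<open>x\<close> times S(o,y); it matches the Leibniz term in which no derivative falls on
  \<open>x\<close>. A nonempty \<open>R\<close> corresponds to a patch at vertex \<open>n\<close>
  whose derivative falls on \<open>x\<close>.

  The label set may be infinite, but only variables occurring in the given polynomials contribute.
  The work is therefore done over a finite set \<open>G\<close> of labels, and the unrestricted sum
  is recovered at the end.\<close>

lemma sorted_list_of_set_image_strict_mono_on:
  fixes e :: "'a::linorder \<Rightarrow> 'c::linorder"
  assumes "strict_mono_on B e" "finite B"
  shows "sorted_list_of_set (e ` B) = map e (sorted_list_of_set B)"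
proof (rule strict_sorted_equal)
  have "sorted_wrt (\<lambda>x y. e x < e y) (sorted_list_of_set B)"
    using assms strict_sorted_list_of_set[of B]
    by (elim sorted_wrt_mono_rel[rotated]) (auto dest: strict_mono_onD)
  then show "sorted_wrt (<) (map e (sorted_list_of_set B))"
    by (simp add: sorted_wrt_map)
qed (use assms in auto)

text \<open>Serves to move the moment formula from list positions to an arbitrary finite index
  set.\<close>

lemma bij_betw_image_partition_on:
  assumes e: "bij_betw e A B"
  shows "bij_betw ((`) ((`) e)) {P. partition_on A P} {P. partition_on B P}"
proof -
  have img: "partition_on (f ` C) ((`) f ` P)" if "partition_on C P" "inj_on f C"
    for f :: "'x \<Rightarrow> 'y" and C P
  proof -
    have "(`) f ` P - {{}} = (`) f ` P"
      using partition_onD3[OF that(1)] by auto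
    then show ?thesis using partition_on_inj_image[OF that] by simp
  qed
  define g where "g = the_inv_into A e"
  have g: "bij_betw g B A"
    using e unfolding g_def by (rule bij_betw_the_inv_into)
  have ge: "g ` e ` V = V" if "V \<subseteq> A" for V
  proof -
    have "g (e v) = v" if "v \<in> V" for v
      using that \<open>V \<subseteq> A\<close> e the_inv_into_f_f[of e A v] unfolding g_def bij_betw_def by auto
    then show ?thesis by (simp add: image_image)
  qed
  have eg: "e ` g ` V = V" if "V \<subseteq> B" for V
  proof -
    have "e (g v) = v" if "v \<in> V" for v
      using that \<open>V \<subseteq> B\<close> e f_the_inv_into_f[of e A v] unfolding g_def bij_betw_def by auto
    then show ?thesis by (simp add: image_image)
  qed
  show ?thesis
  proof (rule bij_betw_byWitness[where f' = "(`) ((`) g)"])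
    show "\<forall>P\<in>{P. partition_on A P}. (`) g ` (`) e ` P = P"
    proof
      fix P assume "P \<in> {P. partition_on A P}"
      then have P: "partition_on A P" by simp
      have "g ` e ` V = V" if "V \<in> P" for V
        using that P by (intro ge) (auto simp: partition_on_def)
      then show "(`) g ` (`) e ` P = P" by (simp only: image_image[of _ _ P] image_ident cong: image_cong)
    qed
    show "\<forall>P\<in>{P. partition_on B P}. (`) e ` (`) g ` P = P"
    proof
      fix P assume "P \<in> {P. partition_on B P}"
      then have P: "partition_on B P" by simp
      have "e ` g ` V = V" if "V \<in> P" for V
        using that P by (intro eg) (auto simp: partition_on_def)
      then show "(`) e ` (`) g ` P = P" by (simp only: image_image[of _ _ P] image_ident cong: image_cong)
    qed
    show "(`) ((`) e) ` {P. partition_on A P} \<subseteq> {P. partition_on B P}"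
      using img[of A _ e] e by (auto simp: bij_betw_def)
    show "(`) ((`) g) ` {P. partition_on B P} \<subseteq> {P. partition_on A P}"
      using img[of B _ g] g by (auto simp: bij_betw_def)
  qed
qed

text \<open>A partition of \<open>insert n A\<close> is the block \<open>insert n R\<close> of
  \<open>n\<close> together with a partition of what remains. The sum thereby becomes linear in the
  weights of the blocks containing \<open>n\<close>.\<close>

lemma sum_partition_on_split_block:
  fixes w :: "'a set \<Rightarrow> 'c::comm_semiring_1"
  assumes "finite A" "n \<notin> A"
  shows "(\<Sum>P | partition_on (insert n A) P. \<Prod>V\<in>P. w V)
       = (\<Sum>R\<in>Pow A. w (insert n R) * (\<Sum>P | partition_on (A - R) P. \<Prod>V\<in>P. w V))"
proof -
  define glue where "glue = (\<lambda>(R,P). insert (insert n R) P)"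
  define block where "block = (\<lambda>P. THE V. V \<in> P \<and> n \<in> V)"
  have fin: "finite {P. partition_on (A - R) P}" for R
    using assms by (intro finitely_many_partition_on) auto
  have "(\<Sum>R\<in>Pow A. w (insert n R) * (\<Sum>P | partition_on (A - R) P. \<Prod>V\<in>P. w V))
      = (\<Sum>(R,P)\<in>Sigma (Pow A) (\<lambda>R. {P. partition_on (A - R) P}). w (insert n R) * (\<Prod>V\<in>P. w V))"
    unfolding sum_distrib_left using assms fin by (subst sum.Sigma) auto
  also have "\<dots> = (\<Sum>P | partition_on (insert n A) P. \<Prod>V\<in>P. w V)"
  proof (rule sum.reindex_bij_witness[where j = glue and i = "\<lambda>P. (block P - {n}, P - {block P})"])
    fix RP assume "RP \<in> Sigma (Pow A) (\<lambda>R. {P. partition_on (A - R) P})"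
    then obtain R P where RP: "RP = (R,P)" and R: "R \<subseteq> A" and P: "partition_on (A - R) P"
      by auto
    have U: "\<Union>P = A - R" using P by (simp add: partition_on_def)
    then have the: "block (glue RP) = insert n R"
      unfolding block_def glue_def RP using assms by (auto intro!: the_equality)
    have notin: "insert n R \<notin> P" using U assms by auto
    show "(block (glue RP) - {n}, glue RP - {block (glue RP)}) = RP"
      unfolding the using notin R assms by (auto simp: RP glue_def)
    show "glue RP \<in> {P. partition_on (insert n A) P}"
      using partition_on_insert[of "insert n R" P "insert n A"] U R P assms unfolding RP glue_def
      by (auto simp: disjnt_iff insert_Diff_if)
    have "finite P" using P assms by (meson finite_Diff finite_elements)
    then show "(\<Prod>V\<in>glue RP. w V)
        = (case RP of (R, P) \<Rightarrow> w (insert n R) * (\<Prod>V\<in>P. w V))"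
      using notin unfolding RP glue_def by simp
  next
    fix P assume "P \<in> {P. partition_on (insert n A) P}"
    then have P: "partition_on (insert n A) P" by simp
    then obtain V where V: "V \<in> P" "n \<in> V" by (auto simp: partition_on_def)
    have the: "block P = V"
      unfolding block_def using V P by (intro the_equality) (auto simp: partition_on_def disjoint_def)
    have VA: "V - {n} \<subseteq> A" using V P by (auto simp: partition_on_def)
    have "partition_on (insert n A - V) (P - {V})"
      using partition_on_insert[of V "P - {V}" "insert n A"] P V
      by (auto simp: insert_absorb disjnt_def partition_on_def disjoint_def)
    moreover have "insert n A - V = A - (V - {n})" using V assms by auto
    ultimately show "(block P - {n}, P - {block P})
        \<in> Sigma (Pow A) (\<lambda>R. {P. partition_on (A - R) P})"
      unfolding the using VA by auto
    show "glue (block P - {n}, P - {block P}) = P"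
      unfolding the glue_def using V by (auto simp: insert_absorb)
  qed
  finally show ?thesis by simp
qed

text \<open>The system is triangular with respect to inclusion: the term \<open>R = B\<close> has
  coefficient \<open>M {} = 1\<close>, and all other terms involve proper subsets, where
  \<open>F\<close> and \<open>G\<close> agree by induction.\<close>

lemma convolution_left_unique:
  fixes F G M :: "'a set \<Rightarrow> 'c::comm_ring_1"
  assumes eq: "\<And>B. B \<subseteq> A \<Longrightarrow> (\<Sum>R\<in>Pow B. F R * M (B - R)) = (\<Sum>R\<in>Pow B. G R * M (B - R))"
    and M: "M {} = 1" and "finite A"
  shows "F A = G A"
proof -
  have "F B = G B" if "B \<subseteq> A" for B
    using finite_subset[OF that \<open>finite A\<close>] that
  proof (induction B rule: finite_psubset_induct)
    case (psubset B)
    have split: "(\<Sum>R\<in>Pow B. h R * M (B - R)) = h B + (\<Sum>R\<in>Pow B - {B}. h R * M (B - R))"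
      for h using psubset.hyps M by (subst sum.remove[of _ B]) auto
    have "(\<Sum>R\<in>Pow B - {B}. F R * M (B - R)) = (\<Sum>R\<in>Pow B - {B}. G R * M (B - R))"
    proof (rule sum.cong[OF refl])
      fix R assume "R \<in> Pow B - {B}"
      then have "F R = G R" using psubset.prems by (intro psubset.IH) auto
      then show "F R * M (B - R) = G R * M (B - R)" by simp
    qed
    then show ?case using eq[OF psubset.prems] unfolding split by simp
  qed
  then show ?thesis by simp
qed

section \<open>Cumulants as functions of indexed families, and their algebraic rules\<close>

text \<open>Indexing the arguments by a set makes subfamilies and complements plain set operations,
  and replacing one argument a function update. The order of the indices supplies the list
  order.\<close>

definition cumulant_on :: "('b list \<Rightarrow> 'f) \<Rightarrow> nat set \<Rightarrow> (nat \<Rightarrow> 'b) \<Rightarrow> 'f" where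
  "cumulant_on kap A f = kap (map f (sorted_list_of_set A))"

locale cumulant_functional =
  fixes sm :: "'f::field \<Rightarrow> 'b::comm_ring_1 \<Rightarrow> 'b"
    and E :: "'b \<Rightarrow> 'f"
    and kap :: "'b list \<Rightarrow> 'f"
  assumes alg: "F_algebra sm"
    and E_add: "E (x + y) = E x + E y"
    and E_smult: "E (sm c x) = c * E x"
    and E_one: "E 1 = 1"
    and moment_list: "os \<noteq> [] \<Longrightarrow> E (prod_list os) =
      (\<Sum>P\<in>set_partitions (length os). \<Prod>V\<in>P. kap (map (\<lambda>j. os ! j) (sorted_list_of_set V)))"
begin

abbreviation "K \<equiv> cumulant_on kap"

definition M :: "nat set \<Rightarrow> (nat \<Rightarrow> 'b) \<Rightarrow> 'f" where
  "M A f = E (\<Prod>i\<in>A. f i)"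

lemma M_empty [simp]: "M {} f = 1"
  by (simp add: M_def E_one)

lemma K_cong: "(\<And>i. i \<in> A \<Longrightarrow> f i = g i) \<Longrightarrow> finite A \<Longrightarrow> K A f = K A g"
  unfolding cumulant_on_def by (auto intro!: arg_cong[of _ _ kap])

lemma M_cong: "(\<And>i. i \<in> A \<Longrightarrow> f i = g i) \<Longrightarrow> M A f = M A g"
  unfolding M_def by (auto intro!: arg_cong[of _ _ E] prod.cong)

lemma moment_partition_sum:
  assumes "finite A"
  shows "M A f = (\<Sum>P | partition_on A P. \<Prod>V\<in>P. K V f)"
\<comment> \<open>The moment formula is assumed for nonempty lists only. For the empty set both
  sides are 1, the right one because of the empty partition.\<close>
proof (cases "A = {}")
  case True
  then show ?thesis by (simp add: partition_on_empty)
next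
  case False
  define xs where "xs = sorted_list_of_set A"
  define e where "e = (\<lambda>j. xs ! j)"
  have len: "length xs = card A" and set: "set xs = A" and dist: "distinct xs"
    and sorted: "sorted_wrt (<) xs"
    using assms by (simp_all add: xs_def)
  have e_bij: "bij_betw e {0..<card A} A"
    unfolding e_def using dist len set by (intro bij_betw_nth) auto
  \<comment> \<open>\<open>kap\<close> acts on ordered lists, so the relabelling must carry the
    sorted list of a block to the sorted list of its image.\<close>
  have e_mono: "strict_mono_on {0..<card A} e"
    using sorted len by (auto simp: e_def strict_mono_on_def sorted_wrt_iff_nth_less)
  have "prod_list (map f xs) = (\<Prod>i\<in>A. f i)"
    using prod.distinct_set_conv_list[OF dist, of f] set by simp
  then have "M A f = E (prod_list (map f xs))" by (simp add: M_def)
  also have "\<dots> = (\<Sum>P\<in>set_partitions (card A).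
      \<Prod>V\<in>P. kap (map (\<lambda>j. map f xs ! j) (sorted_list_of_set V)))"
  proof -
    have "map f xs \<noteq> []" using False set by auto
    from moment_list[OF this] show ?thesis by (simp only: length_map len)
  qed
  also have "\<dots> = (\<Sum>P\<in>set_partitions (card A). \<Prod>V\<in>(`) e ` P. K V f)"
  proof (rule sum.cong[OF refl])
    fix P assume "P \<in> set_partitions (card A)"
    then have P: "\<And>V. V \<in> P \<Longrightarrow> V \<subseteq> {0..<card A}"
      by (auto simp: set_partitions_def partition_on_def)
    have inj: "inj_on ((`) e) P"
      using inj_on_image_Pow[of e "{0..<card A}"] e_bij P
      by (auto simp: bij_betw_def intro: inj_on_subset)
    have "kap (map (\<lambda>j. map f xs ! j) (sorted_list_of_set V)) = K (e ` V) f" if "V \<in> P" for V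
    proof -
      have V: "V \<subseteq> {0..<card A}" "finite V"
        using P[OF that] finite_subset by auto
      have "map (\<lambda>j. map f xs ! j) (sorted_list_of_set V) = map f (map e (sorted_list_of_set V))"
        using V len by (auto simp: e_def intro!: nth_map)
      also have "map e (sorted_list_of_set V) = sorted_list_of_set (e ` V)"
        using V monotone_on_subset[OF e_mono]
        by (subst sorted_list_of_set_image_strict_mono_on) auto
      finally show ?thesis by (simp add: cumulant_on_def)
    qed
    then show "(\<Prod>V\<in>P. kap (map (\<lambda>j. map f xs ! j) (sorted_list_of_set V))) = (\<Prod>V\<in>(`) e ` P. K V f)"
      by (simp add: prod.reindex[OF inj])
  qed
  also have "\<dots> = (\<Sum>P | partition_on A P. \<Prod>V\<in>P. K V f)"
    unfolding set_partitions_def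
    by (rule sum.reindex_bij_betw[OF bij_betw_image_partition_on[OF e_bij]])
  finally show ?thesis .
qed

lemma moment_insert:
  assumes "finite A" "n \<notin> A"
  shows "M (insert n A) f = (\<Sum>R\<in>Pow A. K (insert n R) f * M (A - R) f)"
  using assms by (simp add: moment_partition_sum sum_partition_on_split_block)

text \<open>The argument \<open>x\<close> enters only through the cumulants whose index set contains
  \<open>n\<close>. For these the identity is a linear system whose coefficients
  \<open>M (A - R) f\<close> do not depend on \<open>x\<close>.\<close>

lemma moment_update:
  assumes "finite A" "n \<notin> A"
  shows "(\<Sum>R\<in>Pow A. K (insert n R) (f(n:=x)) * M (A - R) f) = E (x * (\<Prod>i\<in>A. f i))"
proof -
  have "(\<Sum>R\<in>Pow A. K (insert n R) (f(n:=x)) * M (A - R) f) =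
        (\<Sum>R\<in>Pow A. K (insert n R) (f(n:=x)) * M (A - R) (f(n:=x)))"
    using assms by (intro sum.cong refl arg_cong2[where f="(*)"] M_cong) auto
  also have "\<dots> = M (insert n A) (f(n:=x))"
    using assms by (simp add: moment_insert)
  also have "\<dots> = E (x * (\<Prod>i\<in>A. f i))"
    using assms by (auto simp: M_def intro!: arg_cong[of _ _ E] arg_cong[of _ _ "\<lambda>z. x * z"] prod.cong)
  finally show ?thesis .
qed

text \<open>Any \<open>F\<close> that solves the linear system on all subsets of \<open>A\<close>
  must be the cumulant. The rules below are proved by exhibiting such an \<open>F\<close>.\<close>

lemma K_eqI:
  assumes "finite A" "n \<notin> A"
    and eq: "\<And>B. B \<subseteq> A \<Longrightarrow> finite B \<Longrightarrow> n \<notin> B \<Longrightarrow>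
      (\<Sum>R\<in>Pow B. F R * M (B - R) f) = E (x * (\<Prod>i\<in>B. f i))"
  shows "K (insert n A) (f(n:=x)) = F A"
proof (rule convolution_left_unique[where M="\<lambda>B. M B f" and F = "\<lambda>R. K (insert n R) (f(n:=x))"])
  fix B assume B: "B \<subseteq> A"
  then have "finite B" "n \<notin> B" using assms finite_subset by auto
  then show "(\<Sum>R\<in>Pow B. K (insert n R) (f(n:=x)) * M (B - R) f) = (\<Sum>R\<in>Pow B. F R * M (B - R) f)"
    by (simp only: moment_update eq[OF B] not_False_eq_True)
qed (use assms in auto)

lemma K_singleton: "K {n} f = E (f n)"
  using moment_insert[of "{}" n f] by (simp add: M_def E_one)

lemma K_add:
  assumes "finite A" "n \<in> A"
  shows "K A (f(n:=x+y)) = K A (f(n:=x)) + K A (f(n:=y))"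
proof -
  have "K (insert n (A-{n})) (f(n:=x+y)) =
      (\<lambda>R. K (insert n R) (f(n:=x)) + K (insert n R) (f(n:=y))) (A-{n})"
    by (rule K_eqI) (use assms in \<open>simp_all only: distrib_right sum.distrib moment_update E_add not_False_eq_True, auto\<close>)
  then show ?thesis using assms by (simp add: insert_absorb)
qed

lemma K_smult:
  assumes "finite A" "n \<in> A"
  shows "K A (f(n:=sm c x)) = c * K A (f(n:=x))"
proof -
  have sm: "sm c x * y = sm c (x * y)" for y
    using alg by (simp add: F_algebra_def)
  have "K (insert n (A-{n})) (f(n:=sm c x)) = (\<lambda>R. c * K (insert n R) (f(n:=x))) (A-{n})"
  proof (rule K_eqI)
    fix B assume "finite B" "n \<notin> B"
    then show "(\<Sum>R\<in>Pow B. c * K (insert n R) (f(n := x)) * M (B - R) f) = E (sm c x * prod f B)"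
      unfolding sm E_smult by (simp only: moment_update[symmetric] sum_distrib_left mult.assoc not_False_eq_True)
  qed (use assms in auto)
  then show ?thesis using assms by (simp add: insert_absorb)
qed

lemma K_sum:
  assumes "finite A" "n \<in> A" "finite I"
  shows "K A (f(n:=\<Sum>i\<in>I. sm (c i) (x i))) = (\<Sum>i\<in>I. c i * K A (f(n:=x i)))"
  using assms(3)
proof (induction I rule: finite_induct)
  case empty
  have "K A (f(n:=0)) = K A (f(n:=0)) + K A (f(n:=0))"
    using K_add[OF assms(1,2), of f 0 0] by simp
  then show ?case by (simp only: sum.empty) (metis add_cancel_right_right)
next
  case (insert i I)
  then show ?case by (simp only: sum.insert not_False_eq_True K_add[OF assms(1,2)] K_smult[OF assms(1,2)])
qed

text \<open>For \<open>x = 1\<close> the system is solved by the function that is 1 at the empty set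
  and 0 elsewhere, since the right-hand side is then \<open>M B f\<close> itself.\<close>

lemma K_one:
  assumes "finite A" "n \<in> A" "A \<noteq> {n}"
  shows "K A (f(n:=1)) = 0"
proof -
  have *: "(\<Sum>R\<in>Pow B. (if R = {} then 1 else 0) * M (B - R) f) = M B f" if "finite B" for B
  proof -
    have "(\<Sum>R\<in>Pow B. (if R = {} then 1 else 0) * M (B - R) f)
        = (\<Sum>R\<in>Pow B. if R = {} then M B f else 0)"
      by (rule sum.cong) auto
    then show ?thesis using that by (simp add: sum.delta)
  qed
  have "K (insert n (A-{n})) (f(n:=1)) = (\<lambda>R. if R = {} then 1 else 0) (A-{n})"
    by (rule K_eqI) (use assms in \<open>simp_all only: *, auto simp: M_def\<close>)
  then show ?thesis using assms by (auto simp: insert_absorb)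
qed

text \<open>This is the symmetry of cumulants: \<open>g\<close> need not preserve the order of the
  indices. Symmetry of \<open>kap\<close> is not assumed; it is inherited from the moments, which
  are expectations of commutative products.\<close>

lemma K_image:
  assumes "finite A" "inj_on g A"
  shows "K (g ` A) f = K A (f \<circ> g)"
proof (cases "A = {}")
  case True
  then show ?thesis by (simp add: cumulant_on_def)
next
  case False
  then obtain n where n: "n \<in> A" by auto
  define A0 where "A0 = A - {n}"
  have A: "A = insert n A0" and A0: "n \<notin> A0" "finite A0"
    using n assms by (auto simp: A0_def)
  have inj: "inj_on g (insert n A0)" using assms A by simp
  have "K (insert n A0) ((f \<circ> g)(n := f (g n))) = (\<lambda>R. K (g ` insert n R) f) A0"
  proof (rule K_eqI)
    fix B assume B: "B \<subseteq> A0" and fB: "finite B"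
    have gn: "g n \<notin> g ` B" using inj B A0 by (auto simp: inj_on_def)
    have injB: "inj_on g B" using inj_on_subset[OF inj, of B] B by auto
    have M: "M (g ` C) f = M C (f \<circ> g)" if "C \<subseteq> B" for C
      using inj_on_subset[OF injB that] by (simp add: M_def prod.reindex)
    have "E (f (g n) * (\<Prod>i\<in>B. (f \<circ> g) i)) = M (insert (g n) (g ` B)) f"
      using fB gn by (simp add: M_def prod.reindex[OF injB])
    also have "\<dots> = (\<Sum>R\<in>Pow (g ` B). K (insert (g n) R) f * M (g ` B - R) f)"
      using fB gn by (simp add: moment_insert)
    also have "\<dots> = (\<Sum>R\<in>Pow B. K (insert (g n) (g ` R)) f * M (g ` B - g ` R) f)"
      unfolding image_Pow_surj[OF refl, symmetric] by (simp add: sum.reindex[OF inj_on_image_Pow[OF injB]])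
    also have "\<dots> = (\<Sum>R\<in>Pow B. K (g ` insert n R) f * M (B - R) (f \<circ> g))"
    proof (rule sum.cong[OF refl])
      fix R assume "R \<in> Pow B"
      then have "g ` B - g ` R = g ` (B - R)"
        using inj_on_image_set_diff[OF injB, of B R] by auto
      then show "K (insert (g n) (g ` R)) f * M (g ` B - g ` R) f = K (g ` insert n R) f * M (B - R) (f \<circ> g)"
        using M[of "B - R"] by auto
    qed
    finally show "(\<Sum>R\<in>Pow B. K (g ` insert n R) f * M (B - R) (f \<circ> g))
        = E (f (g n) * (\<Prod>i\<in>B. (f \<circ> g) i))" by simp
  qed (use A0 in auto)
  then show ?thesis using A by (simp add: fun_upd_idem)
qed

text \<open>The fresh index \<open>n'\<close> carries the second factor, so that the moment with
  \<open>x * y\<close> at \<open>n\<close> is a moment with two separate arguments. Its partitions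
  are sorted by whether \<open>n\<close> and \<open>n'\<close> share a block; if not, the block of
  \<open>n'\<close> is split off as well.\<close>

lemma K_mult:
  assumes "finite A" "n \<in> A" "n' \<notin> A"
  shows "K A (f(n:=x*y)) = K (insert n' A) (f(n:=x, n':=y)) +
     (\<Sum>R\<in>Pow (A - {n}). K (insert n R) (f(n:=x)) * K (A - R) (f(n:=y)))"
proof -
  define A0 where "A0 = A - {n}"
  have A: "A = insert n A0" and A0: "n \<notin> A0" "finite A0" "n' \<notin> A0" "n \<noteq> n'"
    using assms by (auto simp: A0_def)
  let ?g = "f(n:=x, n':=y)"
  have "K (insert n A0) (f(n:=x*y)) = (\<lambda>B. K (insert n (insert n' B)) ?g +
     (\<Sum>R\<in>Pow B. K (insert n R) ?g * K (insert n' (B - R)) ?g)) A0"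
  proof (rule K_eqI)
    fix B assume B: "B \<subseteq> A0" and fB: "finite B"
    have nB: "n \<notin> B" "n' \<notin> B" using A0 B by auto
    have M: "M C f = M C ?g" if "C \<subseteq> B" for C
      using that nB by (intro M_cong) auto
    \<comment> \<open>Both double sums run over the ordered decompositions of \<open>B\<close> into
      three disjoint parts.\<close>
    have swap: "(\<Sum>R\<in>Pow B. \<Sum>S\<in>Pow R. h S (R - S) (B - R)) =
        (\<Sum>S\<in>Pow B. \<Sum>Q\<in>Pow (B - S). h S Q (B - S - Q))" for h :: "_ \<Rightarrow> _ \<Rightarrow> _ \<Rightarrow> 'f"
    proof -
      have "(\<Sum>R\<in>Pow B. \<Sum>S\<in>Pow R. h S (R - S) (B - R)) =
          (\<Sum>(R,S)\<in>Sigma (Pow B) Pow. h S (R - S) (B - R))"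
        using fB by (subst sum.Sigma) (auto intro: finite_subset)
      also have "\<dots> = (\<Sum>(S,Q)\<in>Sigma (Pow B) (\<lambda>S. Pow (B - S)). h S Q (B - S - Q))"
        by (rule sum.reindex_bij_witness[where i = "\<lambda>(S,Q). (S \<union> Q, S)" and j = "\<lambda>(R,S). (S, R - S)"])
           (auto intro!: arg_cong2[where f="h _"])
      also have "\<dots> = (\<Sum>S\<in>Pow B. \<Sum>Q\<in>Pow (B - S). h S Q (B - S - Q))"
        using fB by (subst sum.Sigma) (auto intro: finite_subset)
      finally show ?thesis .
    qed
    have "E (x * y * (\<Prod>i\<in>B. f i)) = M (insert n (insert n' B)) ?g"
    proof -
      have "(\<Prod>i\<in>B. ?g i) = (\<Prod>i\<in>B. f i)" using nB by (intro prod.cong) auto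
      then show ?thesis using A0 nB fB by (simp add: M_def mult.assoc)
    qed
    also have "\<dots> = (\<Sum>R\<in>Pow (insert n' B). K (insert n R) ?g * M (insert n' B - R) ?g)"
      using A0 nB fB by (simp add: moment_insert)
    also have "\<dots> = (\<Sum>R\<in>Pow B. K (insert n R) ?g * M (insert n' B - R) ?g) +
        (\<Sum>R\<in>insert n' ` Pow B. K (insert n R) ?g * M (insert n' B - R) ?g)"
      unfolding Pow_insert using fB nB by (intro sum.union_disjoint) auto
    also have "(\<Sum>R\<in>insert n' ` Pow B. K (insert n R) ?g * M (insert n' B - R) ?g)
        = (\<Sum>R\<in>Pow B. K (insert n (insert n' R)) ?g * M (B - R) ?g)"
    proof (subst sum.reindex)
      show "inj_on (insert n') (Pow B)" using nB by (auto simp: inj_on_def)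
      have "insert n' B - insert n' R = B - R" if "R \<in> Pow B" for R using nB that by auto
      then show "sum ((\<lambda>R. K (insert n R) ?g * M (insert n' B - R) ?g) \<circ> insert n') (Pow B)
          = (\<Sum>R\<in>Pow B. K (insert n (insert n' R)) ?g * M (B - R) ?g)"
        by (intro sum.cong) auto
    qed
    also have "(\<Sum>R\<in>Pow B. K (insert n R) ?g * M (insert n' B - R) ?g)
       = (\<Sum>S\<in>Pow B. \<Sum>Q\<in>Pow (B - S). K (insert n S) ?g * (K (insert n' Q) ?g * M (B - S - Q) ?g))"
    proof (rule sum.cong[OF refl])
      fix R assume "R \<in> Pow B"
      then have "insert n' B - R = insert n' (B - R)" using nB by auto
      then show "K (insert n R) ?g * M (insert n' B - R) ?g
        = (\<Sum>Q\<in>Pow (B - R). K (insert n R) ?g * (K (insert n' Q) ?g * M (B - R - Q) ?g))"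
        using fB nB by (simp add: moment_insert sum_distrib_left)
    qed
    also have "\<dots> = (\<Sum>R\<in>Pow B. (\<Sum>S\<in>Pow R. K (insert n S) ?g * K (insert n' (R - S)) ?g) * M (B - R) ?g)"
      using swap[of "\<lambda>S Q C. K (insert n S) ?g * (K (insert n' Q) ?g * M C ?g)"]
      by (simp only: sum_distrib_right mult.assoc)
    finally show "(\<Sum>R\<in>Pow B. (K (insert n (insert n' R)) ?g +
       (\<Sum>S\<in>Pow R. K (insert n S) ?g * K (insert n' (R - S)) ?g)) * M (B - R) f)
       = E (x * y * (\<Prod>i\<in>B. f i))"
      by (simp only: M Pow_iff Diff_subset distrib_right sum.distrib add.commute cong: sum.cong)
  qed (use A0 in auto)
  also have "insert n (insert n' A0) = insert n' A" using A by auto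
  also have "(\<Sum>R\<in>Pow A0. K (insert n R) ?g * K (insert n' (A0 - R)) ?g) =
    (\<Sum>R\<in>Pow (A - {n}). K (insert n R) (f(n:=x)) * K (A - R) (f(n:=y)))"
  proof (rule sum.cong)
    fix R assume "R \<in> Pow (A - {n})"
    then have R: "R \<subseteq> A0" by (simp add: A0_def)
    have fR: "finite R" using R A0 finite_subset by auto
    have 1: "K (insert n R) ?g = K (insert n R) (f(n:=x))"
      using R A0 fR by (intro K_cong) auto
    \<comment> \<open>Renaming \<open>n\<close> to \<open>n'\<close> may move the argument to
      another place in the sorted list, so symmetry is required here.\<close>
    let ?h = "id(n := n')"
    have inj: "inj_on ?h (A - R)" using assms by (auto simp: inj_on_def)
    have img: "?h ` (A - R) = insert n' (A0 - R)" using A A0 R by auto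
    have "K (insert n' (A0 - R)) ?g = K (A - R) (?g \<circ> ?h)"
      using K_image[OF _ inj, of ?g] assms img by simp
    also have "\<dots> = K (A - R) (f(n:=y))"
      using assms A0 by (intro K_cong) auto
    finally show "K (insert n R) ?g * K (insert n' (A0 - R)) ?g =
      K (insert n R) (f(n:=x)) * K (A - R) (f(n:=y))" using 1 by simp
  qed (simp add: A0_def)
  finally show ?thesis by (simp only: A[symmetric])
qed

end

section \<open>Hypertrees\<close>

text \<open>Connectedness is phrased by vertex cuts, each of which some edge must cross, whereas
  \<open>connected_cover\<close> divides the family of patches. Cuts fit an argument that divides
  the vertex set. On at least two vertices this also forces every vertex into an edge.\<close>

definition hconnected :: "'v set \<Rightarrow> ('i \<Rightarrow> 'v set) \<Rightarrow> 'i set \<Rightarrow> bool" where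
  "hconnected A e I \<longleftrightarrow>
     (\<forall>B. B \<subseteq> A \<and> B \<noteq> {} \<and> B \<noteq> A \<longrightarrow> (\<exists>i\<in>I. e i \<inter> B \<noteq> {} \<and> e i \<inter> (A - B) \<noteq> {}))"

lemma hconnectedD:
  assumes "hconnected A e I" "B \<subseteq> A" "B \<noteq> {}" "B \<noteq> A"
  obtains i where "i \<in> I" "e i \<inter> B \<noteq> {}" "e i \<inter> (A - B) \<noteq> {}"
  using assms unfolding hconnected_def by blast

text \<open>Crossing is symmetric in a cut and its complement, so the side without \<open>n\<close>
  may be chosen.\<close>

lemma hconnectedI_avoiding:
  assumes "n \<in> A"
    and "\<And>B. B \<subseteq> A \<Longrightarrow> B \<noteq> {} \<Longrightarrow> n \<notin> B \<Longrightarrow> \<exists>i\<in>I. e i \<inter> B \<noteq> {} \<and> e i \<inter> (A - B) \<noteq> {}"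
  shows "hconnected A e I"
  unfolding hconnected_def
proof (intro allI impI)
  fix B assume B: "B \<subseteq> A \<and> B \<noteq> {} \<and> B \<noteq> A"
  show "\<exists>i\<in>I. e i \<inter> B \<noteq> {} \<and> e i \<inter> (A - B) \<noteq> {}"
  proof (cases "n \<in> B")
    case False
    then show ?thesis using assms(2)[of B] B by auto
  next
    case True
    then have "\<exists>i\<in>I. e i \<inter> (A - B) \<noteq> {} \<and> e i \<inter> (A - (A - B)) \<noteq> {}"
      using B by (intro assms(2)) auto
    then show ?thesis using B by (metis double_diff order_refl)
  qed
qed

text \<open>The edges are indexed, since erasing a vertex from the edges of a hypergraph may make
  distinct edges coincide.\<close>
lemma card_le_hconnected:
  assumes "hconnected A e I" "finite A" "finite I"
    and sub: "\<And>i. i \<in> I \<Longrightarrow> e i \<subseteq> A"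
  shows "card A \<le> 1 + (\<Sum>i\<in>I. card (e i) - 1)"
proof (cases "A = {}")
  case False
  then obtain v where v: "v \<in> A" by auto
  \<comment> \<open>The vertex set is explored from \<open>v\<close>. An edge that meets the
    explored set adds at most its cardinality minus one new vertices, and a largest explored set
    must be \<open>A\<close>, since otherwise an edge would leave it.\<close>
  define good where "good B \<longleftrightarrow> B \<subseteq> A \<and> v \<in> B \<and>
    (\<exists>J\<subseteq>I. (\<forall>i\<in>J. e i \<subseteq> B) \<and> card B \<le> 1 + (\<Sum>i\<in>J. card (e i) - 1))" for B
  have "good {v}" using v by (auto simp: good_def)
  moreover have "card B < Suc (card A)" if "good B" for B
    using that assms by (auto simp: good_def less_Suc_eq_le intro: card_mono)
  ultimately obtain B where B: "good B" and max: "\<And>C. good C \<Longrightarrow> card C \<le> card B"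
    using ex_has_greatest_nat[of good "{v}" card "Suc (card A)"] by (metis less_imp_le_nat)
  then obtain J where J: "J \<subseteq> I" "\<forall>i\<in>J. e i \<subseteq> B" "card B \<le> 1 + (\<Sum>i\<in>J. card (e i) - 1)"
    and BA: "B \<subseteq> A" "v \<in> B" by (auto simp: good_def)
  have fB: "finite B" using BA(1) assms(2) by (rule finite_subset)
  have "B = A"
  proof (rule ccontr)
    assume "B \<noteq> A"
    then obtain i where i: "i \<in> I" "e i \<inter> B \<noteq> {}" "e i \<inter> (A - B) \<noteq> {}"
      using hconnectedD[OF assms(1) BA(1)] BA by blast
    have fi: "finite (e i)" using sub[OF i(1)] assms(2) by (rule finite_subset)
    have iJ: "i \<notin> J" using i J by auto
    have "card (B \<union> e i) = card B + card (e i - B)"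
      using fB fi by (metis Un_Diff_cancel card_Un_disjoint Diff_disjoint finite_Diff)
    moreover have "card (e i - B) \<le> card (e i) - 1"
    proof -
      have "e i - B \<subset> e i" using i by auto
      then have "card (e i - B) < card (e i)" using fi by (rule psubset_card_mono[rotated])
      then show ?thesis by simp
    qed
    moreover have "(\<Sum>j\<in>insert i J. card (e j) - 1) = (card (e i) - 1) + (\<Sum>j\<in>J. card (e j) - 1)"
      using iJ finite_subset[OF J(1) assms(3)] by simp
    ultimately have "card (B \<union> e i) \<le> 1 + (\<Sum>j\<in>insert i J. card (e j) - 1)"
      using J by simp
    then have "good (B \<union> e i)"
      unfolding good_def using BA i sub J by (intro conjI exI[of _ "insert i J"]) auto
    then have "card (B \<union> e i) \<le> card B" by (rule max)
    moreover have "B \<subset> B \<union> e i" using i by auto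
    then have "card B < card (B \<union> e i)" using fB fi by (intro psubset_card_mono) auto
    ultimately show False by simp
  qed
  moreover have "(\<Sum>i\<in>J. card (e i) - 1) \<le> (\<Sum>i\<in>I. card (e i) - 1)"
    using J assms by (intro sum_mono2) auto
  ultimately show ?thesis using J by simp
qed simp

text \<open>For \<open>n \<ge> 2\<close> the minimal connected covers are the hypertrees on \<open>{0..<n}\<close>; on a single
  vertex the empty edge set is admitted as well.\<close>
definition hypertrees :: "'v set \<Rightarrow> 'v set set set" where
  "hypertrees A = {U. U \<subseteq> Pow A \<and> hconnected A (\<lambda>V. V) U \<and>
     (\<Sum>V\<in>U. card V - 1) = card A - 1 \<and> (\<forall>V\<in>U. 2 \<le> card V)}"

lemma hypertreesD:
  assumes "U \<in> hypertrees A"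
  shows "\<And>V. V \<in> U \<Longrightarrow> V \<subseteq> A" "hconnected A (\<lambda>V. V) U" "(\<Sum>V\<in>U. card V - 1) = card A - 1"
    "\<And>V. V \<in> U \<Longrightarrow> 2 \<le> card V" "\<And>V. V \<in> U \<Longrightarrow> V \<noteq> {}"
  using assms unfolding hypertrees_def by (blast | fastforce)+

lemma finite_hypertrees:
  assumes "finite A"
  shows "finite (hypertrees A)" "U \<in> hypertrees A \<Longrightarrow> finite U"
proof -
  have "hypertrees A \<subseteq> Pow (Pow A)" by (auto simp: hypertrees_def)
  then show "finite (hypertrees A)" using assms finite_subset by blast
  show "finite U" if "U \<in> hypertrees A"
    using that assms unfolding hypertrees_def by (auto intro: finite_subset[of U "Pow A"])
qed

lemma hypertrees_singleton: "hypertrees {n} = {{}}"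
proof
  have "V \<notin> U" if "U \<in> hypertrees {n}" for U V
  proof
    assume "V \<in> U"
    then have "V \<subseteq> {n}" "2 \<le> card V" using hypertreesD[OF that] by auto
    then show False using card_mono[of "{n}" V] by simp
  qed
  then show "hypertrees {n} \<subseteq> {{}}" by blast
  show "{{}} \<subseteq> hypertrees {n}" by (auto simp: hypertrees_def hconnected_def)
qed

lemma hypertrees_vertex_edge:
  assumes "U \<in> hypertrees A" "k \<in> A" "A \<noteq> {k}"
  shows "{V\<in>U. k \<in> V} \<noteq> {}"
  using hconnectedD[OF hypertreesD(2)[OF assms(1)], of "{k}"] assms by auto

text \<open>The index is the sum of \<open>card V - 1\<close>, where truncated subtraction is
  harmless because patches have at least two points. What remains is to match the two notions of
  connectedness. The bound on \<open>n\<close> matters: on one vertex \<open>Cmin\<close> is empty,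
  while the edgeless hypertree exists.\<close>

lemma Cmin_eq_hypertrees:
  assumes "2 \<le> n"
  shows "Cmin n = hypertrees {0..<n}"
proof -
  let ?A = "{0..<n}"
  have index: "cover_index U = int n - 1 \<longleftrightarrow> (\<Sum>V\<in>U. card V - 1) = card ?A - 1"
    if "\<forall>V\<in>U. 2 \<le> card V" for U :: "nat set set"
  proof -
    have "cover_index U = (\<Sum>V\<in>U. int (card V) - 1)"
      by (simp add: cover_index_def sum_subtractf)
    also have "\<dots> = (\<Sum>V\<in>U. int (card V - 1))"
      using that by (intro sum.cong) (auto simp: of_nat_diff)
    also have "\<dots> = int (\<Sum>V\<in>U. card V - 1)" by simp
    finally have "cover_index U = int (\<Sum>V\<in>U. card V - 1)" .
    moreover have "card ?A - 1 = n - 1" by simp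
    ultimately show ?thesis using assms by linarith
  qed
  have conn: "connected_cover n U \<longleftrightarrow> U \<subseteq> Pow ?A \<and> hconnected ?A (\<lambda>V. V) U"
    if ne: "\<forall>V\<in>U. 2 \<le> card V" for U
  proof
    assume cc: "connected_cover n U"
    have "hconnected ?A (\<lambda>V. V) U"
      unfolding hconnected_def
    proof (intro allI impI, rule ccontr)
      fix B assume B: "B \<subseteq> ?A \<and> B \<noteq> {} \<and> B \<noteq> ?A"
        and no: "\<not> (\<exists>V\<in>U. V \<inter> B \<noteq> {} \<and> V \<inter> (?A - B) \<noteq> {})"
      \<comment> \<open>If no patch crosses the cut, the patches meeting \<open>B\<close> and the
        remaining ones have disjoint unions. Neither family is empty, because the cover reaches both
        sides of the cut.\<close>
      define W where "W = {V\<in>U. V \<inter> B \<noteq> {}}"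
      have UA: "\<Union>U = ?A" using cc by (simp add: connected_cover_def)
      have WB: "\<Union>W \<subseteq> B" using no UA by (auto simp: W_def)
      have "\<Union>(U - W) \<inter> B = {}" by (auto simp: W_def)
      then have disj: "\<Union>W \<inter> \<Union>(U - W) = {}" using WB by auto
      obtain v where "v \<in> B" using B by auto
      then have "v \<in> \<Union>U" using B UA by auto
      then have "W \<noteq> {}" using \<open>v \<in> B\<close> by (auto simp: W_def)
      moreover have "W \<noteq> U" using WB UA B by auto
      moreover have "W \<subseteq> U" by (auto simp: W_def)
      ultimately show False using cc disj unfolding connected_cover_def by metis
    qed
    then show "U \<subseteq> Pow ?A \<and> hconnected ?A (\<lambda>V. V) U"
      using cc by (auto simp: connected_cover_def)
  next
    assume h: "U \<subseteq> Pow ?A \<and> hconnected ?A (\<lambda>V. V) U"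
    have nonempty: "V \<noteq> {}" if "V \<in> U" for V using ne that by fastforce
    have "v \<in> \<Union>U" if v: "v \<in> ?A" for v
    proof -
      have "?A \<noteq> {v}"
      proof
        assume "?A = {v}"
        then have "card ?A = card {v}" by (rule arg_cong)
        then show False using assms by simp
      qed
      then obtain V where "V \<in> U" "V \<inter> {v} \<noteq> {}"
        using hconnectedD[OF conjunct2[OF h], of "{v}"] v
        by (metis empty_subsetI insert_subset insert_not_empty)
      then show ?thesis by auto
    qed
    moreover have "\<Union>W \<inter> \<Union>(U - W) \<noteq> {}" if W: "W \<subseteq> U" "W \<noteq> {}" "W \<noteq> U" for W
    \<comment> \<open>If \<open>W\<close> already covers everything, any patch outside
      \<open>W\<close> shares its points with it. Otherwise the union of \<open>W\<close> is a cut,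
      and the patch crossing it cannot belong to \<open>W\<close>.\<close>
    proof (cases "\<Union>W = ?A")
      case True
      obtain V where V: "V \<in> U - W" using W by auto
      then obtain v where "v \<in> V" using nonempty[of V] by auto
      moreover have "V \<subseteq> ?A" using V h by blast
      ultimately have "v \<in> \<Union>(U - W)" "v \<in> \<Union>W" unfolding True using V by blast+
      then show ?thesis by (metis IntI emptyE)
    next
      case False
      have "\<Union>W \<subseteq> ?A" using W h by auto
      moreover have "\<Union>W \<noteq> {}" using W nonempty by blast
      ultimately obtain V where "V \<in> U" "V \<inter> \<Union>W \<noteq> {}" "V \<inter> (?A - \<Union>W) \<noteq> {}"
        using hconnectedD[OF conjunct2[OF h], of "\<Union>W"] False by metis
      moreover from this have "V \<in> U - W" by auto
      ultimately show ?thesis by auto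
    qed
    ultimately show "connected_cover n U"
      using h unfolding connected_cover_def by (intro conjI allI impI ballI) auto
  qed
  show ?thesis unfolding Cmin_def hypertrees_def by (intro Collect_cong) (metis index conn)
qed

section \<open>Cutting and gluing hypertrees at a vertex\<close>

text \<open>The two vertex sets share only \<open>n\<close>, so a common edge would have at most one
  point. A cut avoiding \<open>n\<close> restricts to a proper nonempty cut of one of the two
  halves, and the edge counts \<open>card R\<close> and \<open>card (A - R) - 1\<close> add up to
  \<open>card A - 1\<close>.\<close>

lemma hypertrees_glue:
  assumes "finite A" "n \<in> A" "R \<subseteq> A - {n}"
    and U1: "U1 \<in> hypertrees (insert n R)" and U2: "U2 \<in> hypertrees (A - R)"
  shows "U1 \<union> U2 \<in> hypertrees A" "U1 \<inter> U2 = {}"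
proof -
  have fR: "finite R" using assms finite_subset by auto
  have fin: "finite U1" "finite U2"
    using finite_hypertrees(2)[OF _ U1] finite_hypertrees(2)[OF _ U2] assms fR by auto
  show disj: "U1 \<inter> U2 = {}"
  proof (rule ccontr)
    assume "U1 \<inter> U2 \<noteq> {}"
    then obtain V where V: "V \<in> U1" "V \<in> U2" by auto
    then have "V \<subseteq> {n}" using hypertreesD(1)[OF U1 V(1)] hypertreesD(1)[OF U2 V(2)] by auto
    then show False using hypertreesD(4)[OF U1 V(1)] card_mono[of "{n}" V] by simp
  qed
  have "hconnected A (\<lambda>V. V) (U1 \<union> U2)"
  proof (rule hconnectedI_avoiding[OF assms(2)])
    fix B assume B: "B \<subseteq> A" "B \<noteq> {}" "n \<notin> B"
    show "\<exists>V\<in>U1 \<union> U2. V \<inter> B \<noteq> {} \<and> V \<inter> (A - B) \<noteq> {}"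
    proof (cases "B \<inter> R = {}")
      case True
      have "B \<subseteq> A - R" "B \<noteq> A - R" using B True assms by auto
      then obtain V where "V \<in> U2" "V \<inter> B \<noteq> {}" "V \<inter> (A - R - B) \<noteq> {}"
        using hconnectedD[OF hypertreesD(2)[OF U2], of B] B by blast
      then show ?thesis by auto
    next
      case False
      have "B \<inter> R \<noteq> insert n R" using B by auto
      then obtain V where "V \<in> U1" "V \<inter> (B \<inter> R) \<noteq> {}" "V \<inter> (insert n R - B \<inter> R) \<noteq> {}"
        using hconnectedD[OF hypertreesD(2)[OF U1], of "B \<inter> R"] False by blast
      then show ?thesis using B assms by (intro bexI[of _ V]) auto
    qed
  qed
  moreover have "(\<Sum>V\<in>U1 \<union> U2. card V - 1) = card A - 1"
  proof -
    have "n \<notin> R" "R \<subseteq> A" using assms by auto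
    then have "card (A - R) = card A - card R" "card R + 1 \<le> card A" "card (insert n R) - 1 = card R"
      using assms fR card_mono[of A "insert n R"] by (auto simp: card_Diff_subset)
    then show ?thesis
      using hypertreesD(3)[OF U1] hypertreesD(3)[OF U2] fin disj by (simp add: sum.union_disjoint)
  qed
  ultimately show "U1 \<union> U2 \<in> hypertrees A"
    using hypertreesD(1,4)[OF U1] hypertreesD(1,4)[OF U2] assms
    unfolding hypertrees_def by blast
qed

text \<open>The part \<open>R\<close> consists of the vertices connected to \<open>V\<close> by edge chains avoiding \<open>n\<close>.
  Erasing \<open>n\<close> from the edges inside \<open>insert n R\<close> leaves a connected hypergraph on \<open>R\<close>, so the
  edge count leaves room for only one edge through \<open>n\<close>.\<close>
lemma hypertrees_split:
  assumes "finite A" "n \<in> A" and U: "U \<in> hypertrees A" and V: "V \<in> U" "n \<in> V"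
  obtains R U1 U2 where "R \<subseteq> A - {n}" "R \<noteq> {}" "U1 \<in> hypertrees (insert n R)" "U2 \<in> hypertrees (A - R)"
    "{W\<in>U1. n \<in> W} = {V}" "U = U1 \<union> U2"
proof -
  define closed where "closed B \<longleftrightarrow> V - {n} \<subseteq> B \<and> B \<subseteq> A - {n} \<and>
    (\<forall>W\<in>U. W \<inter> B \<noteq> {} \<longrightarrow> W - {n} \<subseteq> B)" for B
  define R where "R = \<Inter>{B. closed B}"
  have sub: "\<And>W. W \<in> U \<Longrightarrow> W \<subseteq> A" using hypertreesD(1)[OF U] .
  have "closed (A - {n})" using sub V by (auto simp: closed_def)
  then have RA: "R \<subseteq> A - {n}" by (auto simp: R_def)
  have R_least: "closed B \<Longrightarrow> R \<subseteq> B" for B by (auto simp: R_def)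
  have VR: "V - {n} \<subseteq> R" by (auto simp: R_def closed_def)
  have R_closed: "W \<subseteq> insert n R" if "W \<in> U" "W \<inter> R \<noteq> {}" for W
  proof -
    have "W - {n} \<subseteq> B" if "closed B" for B
      using \<open>W \<in> U\<close> \<open>W \<inter> R \<noteq> {}\<close> R_least[OF that] that unfolding closed_def by blast
    then show ?thesis by (auto simp: R_def)
  qed
  have fA: "finite W" if "W \<in> U" for W using sub[OF that] assms finite_subset by auto
  have not_sub_n: "\<not> W \<subseteq> {n}" if "W \<in> U" for W
    using hypertreesD(4)[OF U that] card_mono[of "{n}" W] by auto
  have fR: "finite R" using RA assms finite_subset by auto
  have Rne: "R \<noteq> {}" using VR not_sub_n[OF V(1)] by auto
  define U1 where "U1 = {W\<in>U. W \<inter> R \<noteq> {}}"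
  define U2 where "U2 = {W\<in>U. W \<inter> R = {}}"
  have U12: "U = U1 \<union> U2" "U1 \<inter> U2 = {}" by (auto simp: U1_def U2_def)
  have fU: "finite U1" "finite U2"
    using finite_hypertrees(2)[OF assms(1) U] U12 by auto
  have U1_sub: "W \<subseteq> insert n R" if "W \<in> U1" for W using that R_closed by (auto simp: U1_def)
  have U2_sub: "W \<subseteq> A - R" if "W \<in> U2" for W using that sub by (auto simp: U2_def)
  have VU1: "V \<in> U1" using V VR not_sub_n[OF V(1)] by (auto simp: U1_def)
  have conn2: "hconnected (A - R) (\<lambda>V. V) U2"
  proof (rule hconnectedI_avoiding)
    show "n \<in> A - R" using assms RA by auto
    fix B assume B: "B \<subseteq> A - R" "B \<noteq> {}" "n \<notin> B"
    then have "B \<subseteq> A" "B \<noteq> A" using assms by auto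
    then obtain W where W: "W \<in> U" "W \<inter> B \<noteq> {}" "W \<inter> (A - B) \<noteq> {}"
      using hconnectedD[OF hypertreesD(2)[OF U]] B by blast
    have "W \<inter> R = {}" using R_closed[OF W(1)] W(2) B by blast
    then show "\<exists>W\<in>U2. W \<inter> B \<noteq> {} \<and> W \<inter> (A - R - B) \<noteq> {}"
      using W by (intro bexI[of _ W]) (auto simp: U2_def)
  qed
  have conn1: "hconnected (insert n R) (\<lambda>V. V) U1"
  proof (rule hconnectedI_avoiding)
    show "n \<in> insert n R" by simp
    fix B assume B: "B \<subseteq> insert n R" "B \<noteq> {}" "n \<notin> B"
    then have "B \<subseteq> A" "B \<noteq> A" "B \<subseteq> R" using assms RA by auto
    then obtain W where W: "W \<in> U" "W \<inter> B \<noteq> {}" "W \<inter> (A - B) \<noteq> {}"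
      using hconnectedD[OF hypertreesD(2)[OF U]] B by blast
    have "W \<in> U1" using W \<open>B \<subseteq> R\<close> by (auto simp: U1_def)
    then show "\<exists>W\<in>U1. W \<inter> B \<noteq> {} \<and> W \<inter> (insert n R - B) \<noteq> {}"
      using W U1_sub by (intro bexI[of _ W]) auto
  qed
  \<comment> \<open>Cuts \<open>B\<close> are chosen to avoid a point \<open>v\<close> of
    \<open>V - {n}\<close>. If \<open>V\<close> meets \<open>B\<close>, then \<open>V\<close>
    crosses the cut. Otherwise \<open>R - B\<close> cannot be closed, as \<open>R\<close> is the
    least closed set, and the edge violating closedness crosses.\<close>
  have connR: "hconnected R (\<lambda>W. W - {n}) U1"
  proof -
    obtain v where v: "v \<in> V - {n}" using not_sub_n[OF V(1)] by auto
    show ?thesis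
    proof (rule hconnectedI_avoiding[of v])
      show "v \<in> R" using v VR by auto
      fix B assume B: "B \<subseteq> R" "B \<noteq> {}" "v \<notin> B"
      show "\<exists>W\<in>U1. (W - {n}) \<inter> B \<noteq> {} \<and> (W - {n}) \<inter> (R - B) \<noteq> {}"
      proof (cases "V \<inter> B = {}")
        case False
        then show ?thesis using v VR VU1 B RA by (intro bexI[of _ V]) auto
      next
        case True
        have "\<not> closed (R - B)" using R_least[of "R - B"] B by auto
        moreover have "V - {n} \<subseteq> R - B" "R - B \<subseteq> A - {n}" using True VR RA by auto
        ultimately obtain W where W: "W \<in> U" "W \<inter> (R - B) \<noteq> {}" "\<not> W - {n} \<subseteq> R - B"
          unfolding closed_def by blast
        have "W \<subseteq> insert n R" using W by (intro R_closed) auto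
        then show ?thesis using W B RA by (intro bexI[of _ W]) (auto simp: U1_def)
      qed
    qed
  qed
  define d where "d = card {W\<in>U1. n \<in> W}"
  have sum1: "(\<Sum>W\<in>U1. card (W - {n}) - 1) + d = (\<Sum>W\<in>U1. card W - 1)"
  proof -
    have "(\<Sum>W\<in>U1. card (W - {n}) - 1) + (\<Sum>W\<in>U1. if n \<in> W then 1 else 0) = (\<Sum>W\<in>U1. card W - 1)"
      unfolding sum.distrib[symmetric]
    proof (rule sum.cong[OF refl])
      fix W assume "W \<in> U1"
      then have "W \<in> U" using U12 by auto
      then have "2 \<le> card W" "finite W" using hypertreesD(4)[OF U] fA by auto
      then show "card (W - {n}) - 1 + (if n \<in> W then 1 else 0) = card W - 1"
        by (auto simp: card_Diff_singleton)
    qed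
    moreover have "(\<Sum>W\<in>U1. if n \<in> W then 1 else 0) = d"
      unfolding d_def using fU by (simp add: sum.If_cases Int_def conj_commute)
    ultimately show ?thesis by simp
  qed
  have cR: "card R \<le> 1 + (\<Sum>W\<in>U1. card (W - {n}) - 1)"
    using connR fR fU U1_sub by (intro card_le_hconnected) auto
  have cR': "card (insert n R) \<le> 1 + (\<Sum>W\<in>U1. card W - 1)"
    using conn1 fR fU U1_sub by (intro card_le_hconnected) auto
  have cA: "card (A - R) \<le> 1 + (\<Sum>W\<in>U2. card W - 1)"
    using conn2 assms fU U2_sub by (intro card_le_hconnected) auto
  have tot: "(\<Sum>W\<in>U1. card W - 1) + (\<Sum>W\<in>U2. card W - 1) = card A - 1"
    using hypertreesD(3)[OF U] U12 fU by (simp add: sum.union_disjoint)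
  have cardA: "card (A - R) = card A - card R" "card R + 1 \<le> card A" and cardR: "card (insert n R) = card R + 1"
  proof -
    have "n \<notin> R" "R \<subseteq> A" using RA by auto
    then show "card (A - R) = card A - card R" "card R + 1 \<le> card A" "card (insert n R) = card R + 1"
      using assms fR card_mono[of A "insert n R"] by (auto simp: card_Diff_subset)
  qed
  \<comment> \<open>The bounds \<open>cR'\<close> and \<open>cA\<close> add up to the total
    \<open>tot\<close>, hence both are equalities. With \<open>sum1\<close>, the bound
    \<open>cR\<close> then leaves room for at most one edge through \<open>n\<close>, and
    \<open>V\<close> is one.\<close>
  have "d \<noteq> 0" using VU1 V fU by (auto simp: d_def)
  then have eq: "(\<Sum>W\<in>U1. card W - 1) = card R" "(\<Sum>W\<in>U2. card W - 1) = card (A - R) - 1" and "d = 1"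
    using cR cR' cA tot cardA cardR sum1 by linarith+
  obtain V' where "{W\<in>U1. n \<in> W} = {V'}"
    using \<open>d = 1\<close> unfolding d_def by (rule card_1_singletonE)
  moreover have "V \<in> {W\<in>U1. n \<in> W}" using VU1 V by simp
  ultimately have leaf: "{W\<in>U1. n \<in> W} = {V}" by simp
  show ?thesis
  proof (rule that[OF RA Rne _ _ leaf U12(1)])
    show "U1 \<in> hypertrees (insert n R)"
      using conn1 U1_sub eq cardR hypertreesD(4)[OF U] U12 unfolding hypertrees_def by auto
    show "U2 \<in> hypertrees (A - R)"
      using conn2 U2_sub eq hypertreesD(4)[OF U] U12 unfolding hypertrees_def by auto
  qed
qed

text \<open>An edge of \<open>U1\<close> that crosses the cut \<open>R - R'\<close> has a vertex
  outside \<open>insert n R'\<close>, so it belongs to \<open>U2'\<close> and misses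
  \<open>R'\<close>. It can leave the cut only through \<open>n\<close>, hence it is
  \<open>V\<close>; but \<open>V\<close> lies in \<open>U1'\<close>.\<close>

lemma hypertrees_split_unique:
  assumes "n \<in> A" "R \<subseteq> A - {n}" "R' \<subseteq> A - {n}"
    and U1: "U1 \<in> hypertrees (insert n R)" and U2: "U2 \<in> hypertrees (A - R)"
    and U1': "U1' \<in> hypertrees (insert n R')" and U2': "U2' \<in> hypertrees (A - R')"
    and leaf: "{W\<in>U1. n \<in> W} = {V}" and leaf': "{W\<in>U1'. n \<in> W} = {V}"
    and eq: "U1 \<union> U2 = U1' \<union> U2'"
  shows "R \<subseteq> R'"
proof (rule ccontr)
  assume not: "\<not> R \<subseteq> R'"
  have "V \<in> U1'" "n \<in> V" "V \<in> U1" using leaf leaf' by auto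
  define B where "B = insert n R - R' - {n}"
  have "B \<subseteq> insert n R" "B \<noteq> {}" "B \<noteq> insert n R" using not assms(2) by (auto simp: B_def)
  then obtain W where W: "W \<in> U1" "W \<inter> B \<noteq> {}" "W \<inter> (insert n R - B) \<noteq> {}"
    using hconnectedD[OF hypertreesD(2)[OF U1]] by blast
  have "W \<notin> U1'" using W(2) hypertreesD(1)[OF U1', of W] by (auto simp: B_def)
  then have "W \<in> U2'" using eq W by auto
  then have "W \<inter> R' = {}" using hypertreesD(1)[OF U2', of W] by auto
  then have "n \<in> W" using W(3) by (auto simp: B_def)
  then have "W = V" using leaf W by auto
  then show False using \<open>V \<in> U1'\<close> \<open>W \<notin> U1'\<close> by simp
qed

text \<open>A hypertree with a marked edge \<open>V\<close> at \<open>n\<close> is the same as a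
  hypertree in which \<open>n\<close> lies on the single edge \<open>V\<close>, glued at
  \<open>n\<close> to a second hypertree. The part \<open>R\<close> is nonempty because it contains
  \<open>V - {n}\<close>.\<close>

lemma sum_hypertrees_marked:
  assumes "finite A" "n \<in> A"
  shows "(\<Sum>U\<in>hypertrees A. \<Sum>V | V \<in> U \<and> n \<in> V. F U V) =
    (\<Sum>R\<in>Pow (A - {n}) - {{}}.
       \<Sum>(U1,V) | U1 \<in> hypertrees (insert n R) \<and> {W\<in>U1. n \<in> W} = {V}. \<Sum>U2\<in>hypertrees (A - R). F (U1 \<union> U2) V)"
proof -
  let ?L = "\<lambda>R. {(U1,V). U1 \<in> hypertrees (insert n R) \<and> {W\<in>U1. n \<in> W} = {V}}"
  let ?X = "Sigma (Pow (A - {n}) - {{}}) (\<lambda>R. ?L R \<times> hypertrees (A - R))"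
  let ?Y = "Sigma (hypertrees A) (\<lambda>U. {V. V \<in> U \<and> n \<in> V})"
  let ?g = "\<lambda>(R, (U1, V), U2). (U1 \<union> U2, V)"
  have fH: "finite (hypertrees (A - R))" for R using assms by (auto intro: finite_hypertrees)
  have fL: "finite (?L R)" if "R \<subseteq> A - {n}" for R
  proof (rule finite_subset)
    show "?L R \<subseteq> hypertrees (insert n R) \<times> Pow (insert n R)"
      using hypertreesD(1) by blast
    show "finite (hypertrees (insert n R) \<times> Pow (insert n R))"
      using that assms finite_subset[of R "A - {n}"] by (auto intro!: finite_hypertrees)
  qed
  have bij: "bij_betw ?g ?X ?Y"
    unfolding bij_betw_def
  proof (intro conjI)
    show "inj_on ?g ?X"
    proof (rule inj_onI)
      fix p p' assume p: "p \<in> ?X" and p': "p' \<in> ?X" and eq: "?g p = ?g p'"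
      obtain R U1 V U2 where pe: "p = (R, (U1, V), U2)" by (metis prod.collapse)
      obtain R' U1' V' U2' where pe': "p' = (R', (U1', V'), U2')" by (metis prod.collapse)
      have h: "R \<subseteq> A - {n}" "U1 \<in> hypertrees (insert n R)" "{W\<in>U1. n \<in> W} = {V}" "U2 \<in> hypertrees (A - R)"
        using p unfolding pe by auto
      have h': "R' \<subseteq> A - {n}" "U1' \<in> hypertrees (insert n R')" "{W\<in>U1'. n \<in> W} = {V'}" "U2' \<in> hypertrees (A - R')"
        using p' unfolding pe' by auto
      have VV: "V = V'" and UU: "U1 \<union> U2 = U1' \<union> U2'" using eq unfolding pe pe' by auto
      have RR: "R = R'"
        using hypertrees_split_unique[OF assms(2) h(1) h'(1) h(2) h(4) h'(2) h'(4) h(3) _ UU]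
          hypertrees_split_unique[OF assms(2) h'(1) h(1) h'(2) h'(4) h(2) h(4) h'(3) _ UU[symmetric]]
          h(3) h'(3) VV by auto
      \<comment> \<open>With \<open>R = R'\<close> the mixed pairs can be glued too, so edges of
        different sides never coincide and the union determines both sides.\<close>
      have "U1 \<inter> U2' = {}" "U1' \<inter> U2 = {}"
        using hypertrees_glue(2)[OF assms h(1,2), of U2'] hypertrees_glue(2)[OF assms h'(1,2), of U2] h h' RR by auto
      moreover have "U1 \<inter> U2 = {}" "U1' \<inter> U2' = {}"
        using hypertrees_glue(2)[OF assms h(1,2,4)] hypertrees_glue(2)[OF assms h'(1,2,4)] by auto
      ultimately have "U1 = U1'" "U2 = U2'" using UU by blast+
      then show "p = p'" unfolding pe pe' using RR VV by simp
    qed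
    show "?g ` ?X = ?Y"
    proof
      show "?g ` ?X \<subseteq> ?Y"
      proof (rule image_subsetI)
        fix p assume p: "p \<in> ?X"
        obtain R U1 V U2 where pe: "p = (R, (U1, V), U2)" by (metis prod.collapse)
        have h: "R \<subseteq> A - {n}" "U1 \<in> hypertrees (insert n R)" "{W\<in>U1. n \<in> W} = {V}" "U2 \<in> hypertrees (A - R)"
          using p unfolding pe by auto
        then have "V \<in> U1" "n \<in> V" by auto
        then show "?g p \<in> ?Y" using hypertrees_glue(1)[OF assms h(1,2,4)] unfolding pe by simp
      qed
      show "?Y \<subseteq> ?g ` ?X"
      proof
        fix y assume "y \<in> ?Y"
        then obtain U V where y: "y = (U,V)" and UV: "U \<in> hypertrees A" "V \<in> U" "n \<in> V" by auto
        from hypertrees_split[OF assms UV] obtain R U1 U2 where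
          "R \<subseteq> A - {n}" "R \<noteq> {}" "U1 \<in> hypertrees (insert n R)" "U2 \<in> hypertrees (A - R)"
          "{W\<in>U1. n \<in> W} = {V}" "U = U1 \<union> U2" .
        then show "y \<in> ?g ` ?X" unfolding y
          by (intro image_eqI[of _ _ "(R, (U1, V), U2)"]) auto
      qed
    qed
  qed
  have "(\<Sum>U\<in>hypertrees A. \<Sum>V | V \<in> U \<and> n \<in> V. F U V) = (\<Sum>(U,V)\<in>?Y. F U V)"
    using assms finite_hypertrees(1)[of A] finite_hypertrees(2)[of A] by (subst sum.Sigma) auto
  also have "\<dots> = (\<Sum>p\<in>?X. case ?g p of (U,V) \<Rightarrow> F U V)"
    by (rule sum.reindex_bij_betw[OF bij, symmetric])
  also have "\<dots> = (\<Sum>R\<in>Pow (A - {n}) - {{}}. \<Sum>p\<in>?L R \<times> hypertrees (A - R). case ?g (R, p) of (U,V) \<Rightarrow> F U V)"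
    using assms fH fL by (subst sum.Sigma) (auto simp: case_prod_unfold)
  also have "\<dots> = (\<Sum>R\<in>Pow (A - {n}) - {{}}. \<Sum>(U1,V)\<in>?L R. \<Sum>U2\<in>hypertrees (A - R). F (U1 \<union> U2) V)"
    by (simp add: sum.cartesian_product case_prod_unfold)
  finally show ?thesis by simp
qed

section \<open>Sums over labelled hypertrees\<close>

text \<open>The counterpart for labels of cutting a hypertree: labellings of the two halves are
  chosen independently.\<close>

lemma sum_PiE_Un_disjoint:
  fixes g h :: "('i \<Rightarrow> 'v) \<Rightarrow> 'c::comm_semiring_1"
  assumes "I \<inter> J = {}" 
  shows "(\<Sum>a\<in>Pi\<^sub>E (I \<union> J) (\<lambda>_. G). g (restrict a I) * h (restrict a J)) =
    (\<Sum>a\<in>Pi\<^sub>E I (\<lambda>_. G). g a) * (\<Sum>a\<in>Pi\<^sub>E J (\<lambda>_. G). h a)"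
proof -
  have "(\<Sum>a\<in>Pi\<^sub>E I (\<lambda>_. G). g a) * (\<Sum>a\<in>Pi\<^sub>E J (\<lambda>_. G). h a) =
    (\<Sum>(x,y)\<in>Pi\<^sub>E I (\<lambda>_. G) \<times> Pi\<^sub>E J (\<lambda>_. G). g x * h y)"
    by (simp add: sum_product sum.cartesian_product)
  also have "\<dots> = (\<Sum>a\<in>Pi\<^sub>E (I \<union> J) (\<lambda>_. G). g (restrict a I) * h (restrict a J))"
  proof (rule sum.reindex_bij_witness[where i = "\<lambda>a. (restrict a I, restrict a J)"
        and j = "\<lambda>(x,y) i. if i \<in> I then x i else y i"])
    fix p assume "p \<in> Pi\<^sub>E I (\<lambda>_. G) \<times> Pi\<^sub>E J (\<lambda>_. G)"
    then obtain x y where p: "p = (x,y)" and x: "x \<in> Pi\<^sub>E I (\<lambda>_. G)" and y: "y \<in> Pi\<^sub>E J (\<lambda>_. G)" by auto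
    have rx: "restrict (\<lambda>i. if i \<in> I then x i else y i) I = x"
      using x by (auto simp: PiE_def extensional_def restrict_def)
    have ry: "restrict (\<lambda>i. if i \<in> I then x i else y i) J = y"
    proof
      show "restrict (\<lambda>i. if i \<in> I then x i else y i) J i = y i" for i
        using y assms by (cases "i \<in> J") (auto simp: PiE_def extensional_def)
    qed
    show "(restrict ((\<lambda>(x,y) i. if i \<in> I then x i else y i) p) I,
           restrict ((\<lambda>(x,y) i. if i \<in> I then x i else y i) p) J) = p"
      by (simp add: p rx ry)
    show "(\<lambda>(x,y) i. if i \<in> I then x i else y i) p \<in> Pi\<^sub>E (I \<union> J) (\<lambda>_. G)"
      using x y by (auto simp: p PiE_def extensional_def Pi_def)
    show "g (restrict ((\<lambda>(x,y) i. if i \<in> I then x i else y i) p) I) *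
          h (restrict ((\<lambda>(x,y) i. if i \<in> I then x i else y i) p) J) = (case p of (x, y) \<Rightarrow> g x * h y)"
      by (simp add: p rx ry)
  next
    fix a assume a: "a \<in> Pi\<^sub>E (I \<union> J) (\<lambda>_. G)"
    then show "(\<lambda>(x,y) i. if i \<in> I then x i else y i) (restrict a I, restrict a J) = a"
      by (intro ext) (auto simp: PiE_def extensional_def)
    show "(restrict a I, restrict a J) \<in> Pi\<^sub>E I (\<lambda>_. G) \<times> Pi\<^sub>E J (\<lambda>_. G)"
      using a by auto
  qed
  finally show ?thesis by simp
qed

text \<open>The variables by which the polynomial at \<open>k\<close> is differentiated, with
  multiplicity; the size of this multiset is the number of patches through \<open>k\<close>. Labels
  sit on incidences \<open>(V, k)\<close>, since a patch has one label for each of its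
  points.\<close>

definition vertex_labels :: "'v set set \<Rightarrow> ('v set \<times> 'v \<Rightarrow> 'a) \<Rightarrow> 'v \<Rightarrow> 'a multiset" where
  "vertex_labels U a k = image_mset (\<lambda>V. a (V, k)) (mset_set {V\<in>U. k \<in> V})"

lemma vertex_labels_cong:
  assumes "\<And>V. V \<in> U \<Longrightarrow> k \<in> V \<Longrightarrow> a (V, k) = a' (V, k)"
    and "{V\<in>U. k \<in> V} = {V\<in>U'. k \<in> V}"
  shows "vertex_labels U a k = vertex_labels U' a' k"
  unfolding vertex_labels_def assms(2)[symmetric]
proof (rule image_mset_cong)
  fix V assume V: "V \<in># mset_set {V\<in>U. k \<in> V}"
  \<comment> \<open>\<open>mset_set\<close> of an infinite set is empty, so the presence of
    \<open>V\<close> implies finiteness.\<close>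
  then have "finite {V\<in>U. k \<in> V}" by (metis empty_iff mset_set.infinite set_mset_empty)
  then show "a (V, k) = a' (V, k)" using V assms(1) by auto
qed

lemma size_vertex_labels: "size (vertex_labels U a k) = card {V\<in>U. k \<in> V}"
  by (simp add: vertex_labels_def)

lemma vertex_labels_leaf: "{V\<in>U. k \<in> V} = {V} \<Longrightarrow> vertex_labels U a k = {#a (V, k)#}"
  by (simp add: vertex_labels_def)

text \<open>Each occurrence of \<open>b\<close> at \<open>k\<close> comes from its own edge
  \<open>V\<close>, and deleting \<open>V\<close> removes exactly that occurrence. The multiplicity
  in the Leibniz rule thus becomes a sum over marked edges.\<close>

lemma count_times_vertex_labels:
  fixes e :: "'a multiset \<Rightarrow> 'f::comm_ring_1"
  assumes "finite U"
  shows "of_nat (count (vertex_labels U a k) b) * e (vertex_labels U a k - {#b#}) =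
    (\<Sum>V | V \<in> U \<and> k \<in> V. if a (V, k) = b then e (vertex_labels (U - {V}) a k) else 0)"
proof -
  let ?N = "{V \<in> U. k \<in> V}"
  have fin: "finite ?N" using assms by simp
  have "(\<Sum>V\<in>?N. if a (V, k) = b then e (vertex_labels (U - {V}) a k) else 0) =
    (\<Sum>V\<in>?N. if a (V, k) = b then e (vertex_labels U a k - {#b#}) else 0)"
  proof (intro sum.cong refl if_cong)
    fix V assume V: "V \<in> ?N" "a (V, k) = b"
    have "{W \<in> U - {V}. k \<in> W} = ?N - {V}" by auto
    moreover have "mset_set ?N = add_mset V (mset_set (?N - {V}))"
      using V fin by (metis mset_set.remove)
    ultimately show "e (vertex_labels (U - {V}) a k) = e (vertex_labels U a k - {#b#})"
      using V(2) by (simp add: vertex_labels_def)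
  qed
  also have "\<dots> = of_nat (card {V \<in> ?N. a (V, k) = b}) * e (vertex_labels U a k - {#b#})"
    using fin by (simp add: sum.If_cases Int_def)
  also have "card {V \<in> ?N. a (V, k) = b} = count (vertex_labels U a k) b"
    using fin by (simp add: vertex_labels_def count_image_mset' count_mset_set
        sum.inter_filter[symmetric] conj_assoc eq_commute[of b])
  finally show ?thesis by simp
qed

text \<open>The values, at the evaluation point, of the derivatives of a single generator \<open>b\<close>.\<close>
definition generator_derivs :: "'a \<Rightarrow> 'f::zero_neq_one \<Rightarrow> 'a multiset \<Rightarrow> 'f" where
  "generator_derivs b x D = (if D = {#} then x else if D = {#b#} then 1 else 0)"

locale hypertree_sum =
  fixes G :: "'a set" and s :: "'v set \<Rightarrow> ('v \<Rightarrow> 'a) \<Rightarrow> 'f::comm_ring_1"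
  assumes s_cong: "(\<And>k. k \<in> V \<Longrightarrow> f k = g k) \<Longrightarrow> s V f = s V g"
    and finite_G: "finite G"
begin

abbreviation labellings :: "'v set set \<Rightarrow> ('v set \<times> 'v \<Rightarrow> 'a) set" where
  "labellings U \<equiv> Pi\<^sub>E (Sigma U (\<lambda>V. V)) (\<lambda>_. G)"

definition edge_weight :: "'v set set \<Rightarrow> ('v set \<times> 'v \<Rightarrow> 'a) \<Rightarrow> 'f" where
  "edge_weight U a = (\<Prod>V\<in>U. s V (\<lambda>k. a (V, k)))"

text \<open>The right-hand side of the cover formula over finitely many labels, with arbitrary
  vertex weights \<open>d k D\<close> in the place of the \<open>D\<close>-derivative of the
  polynomial at \<open>k\<close>. This freedom allows the weight at one vertex to be changed at a
  time.\<close>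

definition hsum :: "'v set \<Rightarrow> ('v \<Rightarrow> 'a multiset \<Rightarrow> 'f) \<Rightarrow> 'f" where
  "hsum A d = (\<Sum>U\<in>hypertrees A. \<Sum>a\<in>labellings U.
     edge_weight U a * (\<Prod>k\<in>A. d k (vertex_labels U a k)))"

lemma edge_weight_restrict:
  assumes "U \<subseteq> U'"
  shows "edge_weight U (restrict a (Sigma U' (\<lambda>V. V))) = edge_weight U a"
  unfolding edge_weight_def using assms by (intro prod.cong refl s_cong) auto

lemma vertex_labels_restrict:
  assumes "{V\<in>U. k \<in> V} = {V\<in>U'. k \<in> V}"
  shows "vertex_labels U (restrict a (Sigma U (\<lambda>V. V))) k = vertex_labels U' a k"
  using assms by (intro vertex_labels_cong) auto

lemma hsum_cong: "(\<And>k D. k \<in> A \<Longrightarrow> d k D = d' k D) \<Longrightarrow> hsum A d = hsum A d'"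
  unfolding hsum_def by (intro sum.cong refl arg_cong2[where f="(*)"] prod.cong) auto

lemma hsum_singleton: "hsum {n} d = d n {#}"
  by (simp add: hsum_def hypertrees_singleton edge_weight_def vertex_labels_def)

lemma hsum_update:
  assumes "finite A" "n \<in> A"
  shows "hsum A (d(n:=e)) = (\<Sum>U\<in>hypertrees A. \<Sum>a\<in>labellings U.
     edge_weight U a * (\<Prod>k\<in>A-{n}. d k (vertex_labels U a k)) * e (vertex_labels U a n))"
  unfolding hsum_def
proof (intro sum.cong refl)
  fix U a
  have "(\<Prod>k\<in>A. (d(n := e)) k (vertex_labels U a k)) =
      e (vertex_labels U a n) * (\<Prod>k\<in>A-{n}. (d(n := e)) k (vertex_labels U a k))"
    using assms by (subst prod.remove[of A n]) auto
  also have "(\<Prod>k\<in>A-{n}. (d(n := e)) k (vertex_labels U a k)) = (\<Prod>k\<in>A-{n}. d k (vertex_labels U a k))"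
    by (intro prod.cong) auto
  finally show "edge_weight U a * (\<Prod>k\<in>A. (d(n := e)) k (vertex_labels U a k)) =
    edge_weight U a * (\<Prod>k\<in>A-{n}. d k (vertex_labels U a k)) * e (vertex_labels U a n)"
    by (simp add: ac_simps)
qed

lemma hsum_linear:
  assumes "finite A" "n \<in> A"
  shows "hsum A (d(n:=(\<lambda>D. \<Sum>i\<in>I. c i * e i D))) = (\<Sum>i\<in>I. c i * hsum A (d(n:=e i)))"
  unfolding hsum_update[OF assms] sum_distrib_left
  by (subst (1 2) sum.swap) (simp add: ac_simps sum.swap[of _ I])

text \<open>With a second vertex present, \<open>n\<close> lies on an edge, so the constant is
  differentiated at least once.\<close>

lemma hsum_one:
  assumes "finite A" "n \<in> A" "A \<noteq> {n}"
  shows "hsum A (d(n:=(\<lambda>D. if D = {#} then 1 else 0))) = 0"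
  unfolding hsum_update[OF assms(1,2)]
proof (intro sum.neutral ballI)
  fix U :: "'v set set" and a :: "'v set \<times> 'v \<Rightarrow> 'a" assume U: "U \<in> hypertrees A"
  have "{V\<in>U. n \<in> V} \<noteq> {}" "finite {V\<in>U. n \<in> V}"
    using hypertrees_vertex_edge[OF U assms(2,3)] finite_hypertrees(2)[OF assms(1) U] by auto
  then have "vertex_labels U a n \<noteq> {#}"
    using size_vertex_labels[of U a n] by (metis card_eq_0_iff size_empty)
  then show "edge_weight U a * (\<Prod>k\<in>A - {n}. d k (vertex_labels U a k)) *
      (if vertex_labels U a n = {#} then 1 else 0) = 0" by simp
qed

text \<open>Second derivatives of a generator vanish, so \<open>n\<close> lies on a single edge,
  whose label at \<open>n\<close> must be \<open>b\<close>. The undifferentiated value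
  \<open>x\<close> does not occur, since a further vertex forces an edge through
  \<open>n\<close>.\<close>

lemma hsum_generator:
  assumes "finite R" "n \<notin> R" "R \<noteq> {}"
  shows "hsum (insert n R) (d(n:=generator_derivs b x)) =
    (\<Sum>(U,V) | U \<in> hypertrees (insert n R) \<and> {W\<in>U. n \<in> W} = {V}. \<Sum>a\<in>labellings U.
       if a (V, n) = b then edge_weight U a * (\<Prod>k\<in>R. d k (vertex_labels U a k)) else 0)"
proof -
  let ?A = "insert n R"
  let ?f = "\<lambda>U. \<Sum>a\<in>labellings U. edge_weight U a * (\<Prod>k\<in>R. d k (vertex_labels U a k)) *
     generator_derivs b x (vertex_labels U a n)"
  let ?H = "{U \<in> hypertrees ?A. \<exists>V. {W\<in>U. n \<in> W} = {V}}"
  have fA: "finite ?A" using assms by simp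
  have "hsum ?A (d(n:=generator_derivs b x)) = (\<Sum>U\<in>hypertrees ?A. ?f U)"
    using assms by (simp add: hsum_update)
  also have "\<dots> = (\<Sum>U\<in>?H. ?f U)"
  proof (rule sum.mono_neutral_right[OF finite_hypertrees(1)[OF fA]])
    show "\<forall>U\<in>hypertrees ?A - ?H. ?f U = 0"
    proof
      fix U assume U: "U \<in> hypertrees ?A - ?H"
      have ne: "{V\<in>U. n \<in> V} \<noteq> {}" "finite {V\<in>U. n \<in> V}"
        using hypertrees_vertex_edge[of U ?A n] U finite_hypertrees(2)[OF fA, of U] assms by auto
      have "card {V\<in>U. n \<in> V} \<noteq> 1"
      proof
        assume "card {V\<in>U. n \<in> V} = 1"
        then obtain V where "{V\<in>U. n \<in> V} = {V}" by (rule card_1_singletonE)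
        then show False using U by blast
      qed
      moreover have "card {V\<in>U. n \<in> V} \<noteq> 0" using ne by simp
      ultimately have "vertex_labels U a n \<noteq> {#}" "vertex_labels U a n \<noteq> {#b#}" for a
        using size_vertex_labels[of U a n] by auto
      then show "?f U = 0" by (simp add: generator_derivs_def)
    qed
  qed auto
  also have "\<dots> = (\<Sum>(U,V) | U \<in> hypertrees ?A \<and> {W\<in>U. n \<in> W} = {V}. \<Sum>a\<in>labellings U.
       if a (V, n) = b then edge_weight U a * (\<Prod>k\<in>R. d k (vertex_labels U a k)) else 0)"
  proof (rule sum.reindex_bij_witness[where i = fst and j = "\<lambda>U. (U, THE V. {W\<in>U. n \<in> W} = {V})"])
    fix U assume U: "U \<in> ?H"
    then obtain V where V: "{W\<in>U. n \<in> W} = {V}" by auto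
    then have the: "(THE V. {W\<in>U. n \<in> W} = {V}) = V" by (intro the_equality) auto
    show "(U, THE V. {W\<in>U. n \<in> W} = {V}) \<in> {(U,V). U \<in> hypertrees ?A \<and> {W\<in>U. n \<in> W} = {V}}"
      unfolding the using U V by simp
    show "(case (U, THE V. {W\<in>U. n \<in> W} = {V}) of (U, V) \<Rightarrow> \<Sum>a\<in>labellings U.
       if a (V, n) = b then edge_weight U a * (\<Prod>k\<in>R. d k (vertex_labels U a k)) else 0) = ?f U"
      unfolding the prod.case vertex_labels_leaf[OF V]
      by (intro sum.cong refl) (simp add: generator_derivs_def)
  next
    fix p assume "p \<in> {(U,V). U \<in> hypertrees ?A \<and> {W\<in>U. n \<in> W} = {V}}"
    then obtain U V where p: "p = (U,V)" and U: "U \<in> hypertrees ?A" and V: "{W\<in>U. n \<in> W} = {V}" by auto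
    then have the: "(THE V. {W\<in>U. n \<in> W} = {V}) = V" by (intro the_equality) auto
    show "(fst p, THE V. {W \<in> fst p. n \<in> W} = {V}) = p" by (simp add: p the)
    show "fst p \<in> ?H" using p U V by auto
  qed simp
  finally show ?thesis .
qed

text \<open>Only hypertrees with at most one edge at each vertex contribute. Their edges are
  pairwise disjoint, and connectedness then leaves only \<open>{A}\<close>, because a smaller edge
  would be a cut crossed by an edge meeting it. The labels are forced to be
  \<open>b\<close>.\<close>

lemma hsum_generators:
  assumes "finite A" "A \<noteq> {}" "\<And>k. k \<in> A \<Longrightarrow> b k \<in> G" "\<And>k. A \<noteq> {k}"
  shows "hsum A (\<lambda>k. generator_derivs (b k) (x k)) = s A b"
proof -
  let ?f = "\<lambda>U. \<Sum>a\<in>labellings U. edge_weight U a *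
     (\<Prod>k\<in>A. generator_derivs (b k) (x k) (vertex_labels U a k))"
  have c2: "2 \<le> card A"
  proof -
    have "card A \<noteq> 0" "card A \<noteq> 1" using assms by (auto simp: card_1_singleton_iff)
    then show ?thesis by simp
  qed
  have A_in: "{A} \<in> hypertrees A"
    using c2 by (auto simp: hypertrees_def hconnected_def)
  have "hsum A (\<lambda>k. generator_derivs (b k) (x k)) = (\<Sum>U\<in>{{A}}. ?f U)"
    unfolding hsum_def
  proof (rule sum.mono_neutral_right[OF finite_hypertrees(1)[OF assms(1)]])
    show "\<forall>U\<in>hypertrees A - {{A}}. ?f U = 0"
    proof
      fix U assume U: "U \<in> hypertrees A - {{A}}"
      have fU: "finite U" using U finite_hypertrees(2)[OF assms(1)] by auto
      have "\<exists>k\<in>A. 2 \<le> card {V\<in>U. k \<in> V}"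
      proof (rule ccontr)
        assume no: "\<not> (\<exists>k\<in>A. 2 \<le> card {V\<in>U. k \<in> V})"
        have uniq: "V = W" if "V \<in> U" "W \<in> U" "k \<in> V" "k \<in> W" for V W k
        proof (rule ccontr)
          assume "V \<noteq> W"
          then have "card {V, W} = 2" by simp
          moreover have "card {V, W} \<le> card {V\<in>U. k \<in> V}"
            using that fU by (intro card_mono) auto
          moreover have "k \<in> A" using that hypertreesD(1)[of U A V] U by auto
          ultimately show False using no by auto
        qed
        have UA: "V = A" if V: "V \<in> U" for V
        proof (rule ccontr)
          assume "V \<noteq> A"
          moreover have "V \<subseteq> A" "V \<noteq> {}" using hypertreesD(1,5)[of U A V] U V by auto
          ultimately obtain W where W: "W \<in> U" "W \<inter> V \<noteq> {}" "W \<inter> (A - V) \<noteq> {}"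
            using hconnectedD[OF hypertreesD(2)[of U A], of V] U by blast
          then have "W = V" using uniq V by blast
          then show False using W by auto
        qed
        obtain k where k: "k \<in> A" using assms by auto
        then have "{V\<in>U. k \<in> V} \<noteq> {}" using hypertrees_vertex_edge[of U A k] U assms by auto
        then have "U = {A}" using UA by auto
        then show False using U by auto
      qed
      then obtain k where k: "k \<in> A" "2 \<le> card {V\<in>U. k \<in> V}" by auto
      have "(\<Prod>k\<in>A. generator_derivs (b k) (x k) (vertex_labels U a k)) = 0" for a
      proof (rule prod_zero[OF assms(1) bexI[OF _ k(1)]])
        have "vertex_labels U a k \<noteq> {#}" "vertex_labels U a k \<noteq> {#b k#}"
          using size_vertex_labels[of U a k] k by auto
        then show "generator_derivs (b k) (x k) (vertex_labels U a k) = 0"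
          by (simp add: generator_derivs_def)
      qed
      then show "?f U = 0" by simp
    qed
  qed (use A_in in auto)
  also have "\<dots> = ?f {A}"
    by (simp only: sum.insert finite.emptyI empty_iff not_False_eq_True sum.empty add_0_right)
  also have "\<dots> = (\<Sum>a\<in>{restrict (\<lambda>(V, k). b k) (Sigma {A} (\<lambda>V. V))}. edge_weight {A} a *
     (\<Prod>k\<in>A. generator_derivs (b k) (x k) (vertex_labels {A} a k)))"
  proof (rule sum.mono_neutral_right)
    show "finite (labellings {A})" using assms finite_G by (intro finite_PiE finite_SigmaI) auto
    show "{restrict (\<lambda>(V, k). b k) (Sigma {A} (\<lambda>V. V))} \<subseteq> labellings {A}"
      using assms by auto
    show "\<forall>a\<in>labellings {A} - {restrict (\<lambda>(V, k). b k) (Sigma {A} (\<lambda>V. V))}. edge_weight {A} a *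
     (\<Prod>k\<in>A. generator_derivs (b k) (x k) (vertex_labels {A} a k)) = 0"
    proof
      fix a assume a: "a \<in> labellings {A} - {restrict (\<lambda>(V, k). b k) (Sigma {A} (\<lambda>V. V))}"
      have "\<exists>k\<in>A. a (A, k) \<noteq> b k"
      proof (rule ccontr)
        assume "\<not> (\<exists>k\<in>A. a (A, k) \<noteq> b k)"
        then have "a = restrict (\<lambda>(V, k). b k) (Sigma {A} (\<lambda>V. V))"
          using a by (intro ext) (auto simp: PiE_def extensional_def restrict_def)
        then show False using a by simp
      qed
      then obtain k where k: "k \<in> A" "a (A, k) \<noteq> b k" by auto
      have "vertex_labels {A} a k = {#a (A, k)#}" using k by (intro vertex_labels_leaf) auto
      then have "generator_derivs (b k) (x k) (vertex_labels {A} a k) = 0"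
        using k by (simp add: generator_derivs_def)
      then have "(\<Prod>k\<in>A. generator_derivs (b k) (x k) (vertex_labels {A} a k)) = 0"
        using k assms by (meson prod_zero)
      then show "edge_weight {A} a *
        (\<Prod>k\<in>A. generator_derivs (b k) (x k) (vertex_labels {A} a k)) = 0" by simp
    qed
  qed
  also have "\<dots> = s A b"
  proof -
    let ?a = "restrict (\<lambda>(V, k). b k) (Sigma {A} (\<lambda>V. V))"
    have "generator_derivs (b k) (x k) (vertex_labels {A} ?a k) = 1" if "k \<in> A" for k
    proof -
      have "vertex_labels {A} ?a k = {#?a (A, k)#}" using that by (intro vertex_labels_leaf) auto
      then show ?thesis using that by (simp add: generator_derivs_def)
    qed
    moreover have "edge_weight {A} ?a = s A b"
      unfolding edge_weight_def by (auto intro!: s_cong)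
    ultimately show ?thesis by simp
  qed
  finally show ?thesis .
qed

text \<open>The weight at \<open>n\<close> is the Leibniz rule for a generator \<open>b\<close> with
  value \<open>x\<close> times a factor with derivatives \<open>e\<close>. In the second term the
  edge whose derivative hits the generator is marked, and the hypertree is cut at \<open>n\<close>
  along this edge.\<close>

lemma hsum_mult:
  assumes "finite A" "n \<in> A"
  shows "hsum A (d(n:=(\<lambda>D. x * e D + of_nat (count D b) * e (D - {#b#})))) =
    (\<Sum>R\<in>Pow (A - {n}). hsum (insert n R) (d(n:=generator_derivs b x)) * hsum (A - R) (d(n:=e)))"
proof -
  let ?c = "\<lambda>A U a. edge_weight U a * (\<Prod>k\<in>A-{n}. d k (vertex_labels U a k))"
  define F where "F U V = (\<Sum>a\<in>labellings U.
     if a (V, n) = b then ?c A U a * e (vertex_labels (U - {V}) a n) else 0)" for U V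
  have fU: "finite U" if "U \<in> hypertrees A" for U using finite_hypertrees(2)[OF assms(1) that] .
  have "hsum A (d(n:=(\<lambda>D. x * e D + of_nat (count D b) * e (D - {#b#})))) =
    x * hsum A (d(n:=e)) + (\<Sum>U\<in>hypertrees A. \<Sum>a\<in>labellings U.
      ?c A U a * (of_nat (count (vertex_labels U a n) b) * e (vertex_labels U a n - {#b#})))"
    unfolding hsum_update[OF assms] by (simp add: distrib_left sum.distrib sum_distrib_left ac_simps)
  also have "(\<Sum>U\<in>hypertrees A. \<Sum>a\<in>labellings U.
      ?c A U a * (of_nat (count (vertex_labels U a n) b) * e (vertex_labels U a n - {#b#}))) =
      (\<Sum>U\<in>hypertrees A. \<Sum>V | V \<in> U \<and> n \<in> V. F U V)"
  proof (rule sum.cong[OF refl])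
    fix U assume U: "U \<in> hypertrees A"
    have "(\<Sum>a\<in>labellings U.
      ?c A U a * (of_nat (count (vertex_labels U a n) b) * e (vertex_labels U a n - {#b#}))) =
      (\<Sum>a\<in>labellings U. \<Sum>V | V \<in> U \<and> n \<in> V.
        if a (V, n) = b then ?c A U a * e (vertex_labels (U - {V}) a n) else 0)"
      unfolding count_times_vertex_labels[OF fU[OF U]] sum_distrib_left
      by (intro sum.cong refl) auto
    then show "(\<Sum>a\<in>labellings U.
      ?c A U a * (of_nat (count (vertex_labels U a n) b) * e (vertex_labels U a n - {#b#}))) =
      (\<Sum>V | V \<in> U \<and> n \<in> V. F U V)"
      unfolding F_def by (subst sum.swap)
  qed
  also have "\<dots> = (\<Sum>R\<in>Pow (A - {n}) - {{}}.
       \<Sum>(U1,V) | U1 \<in> hypertrees (insert n R) \<and> {W\<in>U1. n \<in> W} = {V}. \<Sum>U2\<in>hypertrees (A - R). F (U1 \<union> U2) V)"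
    using assms by (rule sum_hypertrees_marked)
  also have "\<dots> = (\<Sum>R\<in>Pow (A - {n}) - {{}}.
     hsum (insert n R) (d(n:=generator_derivs b x)) * hsum (A - R) (d(n:=e)))"
  proof (rule sum.cong[OF refl])
    fix R assume "R \<in> Pow (A - {n}) - {{}}"
    then have R: "R \<subseteq> A - {n}" "R \<noteq> {}" "finite R" "n \<notin> R" using assms finite_subset by auto
    have nAR: "n \<in> A - R" "finite (A - R)" using R assms by auto
    let ?g1 = "\<lambda>U V. \<Sum>a\<in>labellings U.
       if a (V, n) = b then edge_weight U a * (\<Prod>k\<in>R. d k (vertex_labels U a k)) else 0"
    let ?g2 = "\<lambda>U. \<Sum>a\<in>labellings U. ?c (A - R) U a * e (vertex_labels U a n)"
    have F: "F (U1 \<union> U2) V = ?g1 U1 V * ?g2 U2"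
      if U1: "U1 \<in> hypertrees (insert n R)" and leaf: "{W\<in>U1. n \<in> W} = {V}"
        and U2: "U2 \<in> hypertrees (A - R)" for U1 U2 V
    proof -
      let ?S1 = "Sigma U1 (\<lambda>V. V)" and ?S2 = "Sigma U2 (\<lambda>V. V)"
      have disj: "U1 \<inter> U2 = {}" and U12: "U1 \<union> U2 \<in> hypertrees A"
        using hypertrees_glue[OF assms R(1) U1 U2] by auto
      have fin: "finite U1" "finite U2" using fU[OF U12] by auto
      have sub1: "\<And>W. W \<in> U1 \<Longrightarrow> W \<subseteq> insert n R" and sub2: "\<And>W. W \<in> U2 \<Longrightarrow> W \<subseteq> A - R"
        using hypertreesD(1)[OF U1] hypertreesD(1)[OF U2] by auto
      have V: "V \<in> U1" "n \<in> V" using leaf by auto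
      have "F (U1 \<union> U2) V = (\<Sum>a\<in>Pi\<^sub>E (?S1 \<union> ?S2) (\<lambda>_. G).
        (if restrict a ?S1 (V, n) = b then edge_weight U1 (restrict a ?S1) *
           (\<Prod>k\<in>R. d k (vertex_labels U1 (restrict a ?S1) k)) else 0) *
        (?c (A - R) U2 (restrict a ?S2) * e (vertex_labels U2 (restrict a ?S2) n)))"
        unfolding F_def Sigma_Un_distrib1
      proof (rule sum.cong[OF refl])
        fix a
        have ew: "edge_weight (U1 \<union> U2) a = edge_weight U1 (restrict a ?S1) * edge_weight U2 (restrict a ?S2)"
          unfolding edge_weight_restrict[OF order_refl] unfolding edge_weight_def
          using fin disj by (rule prod.union_disjoint)
        have l1: "vertex_labels U1 (restrict a ?S1) k = vertex_labels (U1 \<union> U2) a k" if "k \<in> R" for k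
          using that sub2 by (intro vertex_labels_restrict) auto
        have l2: "vertex_labels U2 (restrict a ?S2) k = vertex_labels (U1 \<union> U2) a k" if "k \<in> A - R - {n}" for k
          using that sub1 by (intro vertex_labels_restrict) auto
        \<comment> \<open>\<open>V\<close> is the only edge of \<open>U1\<close> at
          \<open>n\<close>, so removing it leaves at \<open>n\<close> precisely the edges of
          \<open>U2\<close>.\<close>
        have ln: "vertex_labels U2 (restrict a ?S2) n = vertex_labels (U1 \<union> U2 - {V}) a n"
          using leaf disj V by (intro vertex_labels_restrict) auto
        have "A - {n} = R \<union> (A - R - {n})" using R by auto
        then have "(\<Prod>k\<in>A - {n}. d k (vertex_labels (U1 \<union> U2) a k)) =
          (\<Prod>k\<in>R. d k (vertex_labels (U1 \<union> U2) a k)) * (\<Prod>k\<in>A - R - {n}. d k (vertex_labels (U1 \<union> U2) a k))"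
          using R assms by (metis (no_types, lifting) prod.union_disjoint Diff_disjoint Int_Diff finite_Diff empty_Diff)
        also have "(\<Prod>k\<in>R. d k (vertex_labels (U1 \<union> U2) a k)) = (\<Prod>k\<in>R. d k (vertex_labels U1 (restrict a ?S1) k))"
          by (intro prod.cong refl) (simp add: l1)
        also have "(\<Prod>k\<in>A - R - {n}. d k (vertex_labels (U1 \<union> U2) a k)) =
            (\<Prod>k\<in>A - R - {n}. d k (vertex_labels U2 (restrict a ?S2) k))"
          by (intro prod.cong refl) (simp add: l2)
        finally have P: "(\<Prod>k\<in>A - {n}. d k (vertex_labels (U1 \<union> U2) a k)) =
          (\<Prod>k\<in>R. d k (vertex_labels U1 (restrict a ?S1) k)) *
          (\<Prod>k\<in>A - R - {n}. d k (vertex_labels U2 (restrict a ?S2) k))" .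
        have rV: "restrict a ?S1 (V, n) = a (V, n)" using V by simp
        show "(if a (V, n) = b then ?c A (U1 \<union> U2) a * e (vertex_labels (U1 \<union> U2 - {V}) a n) else 0) =
          (if restrict a ?S1 (V, n) = b then edge_weight U1 (restrict a ?S1) *
           (\<Prod>k\<in>R. d k (vertex_labels U1 (restrict a ?S1) k)) else 0) *
          (?c (A - R) U2 (restrict a ?S2) * e (vertex_labels U2 (restrict a ?S2) n))"
          unfolding ew ln rV P
          by (cases "a (V, n) = b") (simp_all only: simp_thms if_True if_False mult_zero_left ac_simps)
      qed
      also have "\<dots> = ?g1 U1 V * ?g2 U2"
        using disj by (intro sum_PiE_Un_disjoint) auto
      finally show ?thesis .
    qed
    have prod_sum: "(\<Sum>(u,v)\<in>X. \<Sum>w\<in>Y. f u v * g w) = (\<Sum>(u,v)\<in>X. f u v) * sum g Y"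
      for f :: "'v set set \<Rightarrow> 'v set \<Rightarrow> 'f" and g :: "'v set set \<Rightarrow> 'f" and X Y
      by (simp add: sum_product case_prod_unfold)
    have "(\<Sum>(U1,V) | U1 \<in> hypertrees (insert n R) \<and> {W\<in>U1. n \<in> W} = {V}. \<Sum>U2\<in>hypertrees (A - R). F (U1 \<union> U2) V) =
      (\<Sum>(U1,V) | U1 \<in> hypertrees (insert n R) \<and> {W\<in>U1. n \<in> W} = {V}. \<Sum>U2\<in>hypertrees (A - R). ?g1 U1 V * ?g2 U2)"
      by (intro sum.cong refl) (auto intro!: sum.cong F)
    also have "\<dots> = (\<Sum>(U1,V) | U1 \<in> hypertrees (insert n R) \<and> {W\<in>U1. n \<in> W} = {V}. ?g1 U1 V) * (\<Sum>U2\<in>hypertrees (A - R). ?g2 U2)"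
      by (rule prod_sum)
    also have "\<dots> = hsum (insert n R) (d(n:=generator_derivs b x)) * hsum (A - R) (d(n:=e))"
      unfolding hsum_generator[OF R(3,4,2)] hsum_update[OF nAR(2,1)] ..
    finally show "(\<Sum>(U1,V) | U1 \<in> hypertrees (insert n R) \<and> {W\<in>U1. n \<in> W} = {V}. \<Sum>U2\<in>hypertrees (A - R). F (U1 \<union> U2) V) =
      hsum (insert n R) (d(n:=generator_derivs b x)) * hsum (A - R) (d(n:=e))" .
  qed
  \<comment> \<open>The Leibniz term without a derivative on the generator supplies the missing
    summand \<open>R = {}\<close>, as the sum over the single vertex \<open>n\<close> is
    \<open>x\<close>.\<close>
  also have "x * hsum A (d(n:=e)) + \<dots> = (\<Sum>R\<in>Pow (A - {n}).
     hsum (insert n R) (d(n:=generator_derivs b x)) * hsum (A - R) (d(n:=e)))"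
    using assms by (simp add: sum.remove[of "Pow (A - {n})" "{}"] hsum_singleton generator_derivs_def)
  finally show ?thesis .
qed

end

section \<open>Derivatives of monomials\<close>

text \<open>The factor arising from \<open>d\<close> differentiations of an \<open>N\<close>-th
  power. Subtraction is done in the ring, so that the product contains a zero factor when
  \<open>d\<close> exceeds \<open>N\<close>.\<close>

definition falling :: "nat \<Rightarrow> nat \<Rightarrow> 'f::comm_ring_1" where
  "falling N d = (\<Prod>i<d. of_nat N - of_nat i)"

lemma falling_0 [simp]: "falling N 0 = 1"
  by (simp add: falling_def)

lemma falling_eq_0: "N < d \<Longrightarrow> falling N d = 0"
  unfolding falling_def by (rule prod_zero) auto

text \<open>This is the Leibniz rule for the derivative of order \<open>Suc d\<close> of one
  variable times its \<open>N\<close>-th power.\<close>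

lemma falling_Suc_Suc:
  "(falling (Suc N) (Suc d) :: 'f::comm_ring_1) = falling N (Suc d) + of_nat (Suc d) * falling N d"
proof -
  have "(falling (Suc N) (Suc d) :: 'f) = of_nat (Suc N) * falling N d"
    unfolding falling_def by (subst prod.lessThan_Suc_shift) simp
  moreover have "(falling N (Suc d) :: 'f) = falling N d * (of_nat N - of_nat d)"
    by (simp add: falling_def)
  ultimately show ?thesis by (simp add: algebra_simps)
qed

lemma pochhammer_eq_falling:
  assumes "d \<le> N"
  shows "pochhammer (of_nat (N - d + 1)) d = (falling N d :: 'f::comm_ring_1)"
proof -
  have "(falling N d :: 'f) = (\<Prod>i<d. of_nat N - of_nat (d - Suc i))"
    unfolding falling_def by (rule prod.nat_diff_reindex[symmetric])
  also have "\<dots> = (\<Prod>i<d. of_nat (N - d + 1) + of_nat i)"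
    using assms by (intro prod.cong refl) (auto simp: of_nat_diff algebra_simps)
  finally show ?thesis by (simp add: pochhammer_prod atLeast0LessThan)
qed

text \<open>The \<open>D\<close>-derivative of the monomial \<open>m\<close>, evaluated at \<open>x\<close>; if \<open>D\<close> is not contained in \<open>m\<close>,
  one of the falling factorials vanishes.\<close>
definition monom_deriv :: "('a \<Rightarrow> 'f::comm_ring_1) \<Rightarrow> 'a multiset \<Rightarrow> 'a multiset \<Rightarrow> 'f" where
  "monom_deriv x D m =
     (\<Prod>a\<in>set_mset D. falling (count m a) (count D a)) * prod_mset (image_mset x (m - D))"

lemma monom_deriv_eq_0:
  fixes x :: "'a \<Rightarrow> 'f::comm_ring_1"
  assumes "\<not> D \<subseteq># m"
  shows "monom_deriv x D m = 0"
proof -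
  obtain a where a: "count m a < count D a" using assms by (auto simp: subseteq_mset_def not_le)
  then have "a \<in> set_mset D" by (metis count_eq_zero_iff not_less0)
  then have "(\<Prod>a\<in>set_mset D. falling (count m a) (count D a) :: 'f) = 0"
    using falling_eq_0[OF a] by (intro prod_zero) auto
  then show ?thesis by (simp add: monom_deriv_def)
qed

lemma monom_deriv_empty: "monom_deriv x D {#} = (if D = {#} then 1 else 0)"
  using monom_deriv_eq_0[of D "{#}" x] by (auto simp: monom_deriv_def)

lemma monom_deriv_generator: "monom_deriv x D {#b#} = generator_derivs b (x b) D"
proof (cases "D \<subseteq># {#b#}")
  case True
  then have "D = {#} \<or> D = {#b#}" by (cases D) (auto simp: insert_subset_eq_iff)
  then show ?thesis by (auto simp: monom_deriv_def generator_derivs_def falling_def)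
next
  case False
  then have "D \<noteq> {#}" "D \<noteq> {#b#}" by auto
  then show ?thesis using monom_deriv_eq_0[OF False, of x] by (simp add: generator_derivs_def)
qed

text \<open>The Leibniz rule for multiplication by the variable \<open>b\<close>, whose higher
  derivatives vanish. All variables other than \<open>b\<close> contribute the same factor
  \<open>C\<close> throughout, which reduces the claim to one variable.\<close>

lemma monom_deriv_add_mset:
  fixes x :: "'a \<Rightarrow> 'f::comm_ring_1"
  shows "monom_deriv x D (add_mset b m) =
     x b * monom_deriv x D m + of_nat (count D b) * monom_deriv x (D - {#b#}) m"
proof -
  let ?X = "\<lambda>m. prod_mset (image_mset x m)"
  define C where "C = (\<Prod>a\<in>set_mset D - {b}. falling (count m a) (count D a) :: 'f)"
  have split: "(\<Prod>a\<in>set_mset D'. falling (count m' a) (count D' a)) = falling (count m' b) (count D' b) * C"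
    if "\<And>a. a \<noteq> b \<Longrightarrow> count D' a = count D a \<and> count m' a = count m a" for D' m'
  proof -
    have mem: "a \<in> set_mset D' \<longleftrightarrow> a \<in> set_mset D" if "a \<noteq> b" for a
      using \<open>\<And>a. a \<noteq> b \<Longrightarrow> _\<close> that by (metis count_eq_zero_iff)
    have "(\<Prod>a\<in>set_mset D'. falling (count m' a) (count D' a) :: 'f) =
        (\<Prod>a\<in>insert b (set_mset D'). falling (count m' a) (count D' a))"
      by (intro prod.mono_neutral_left) (auto simp: not_in_iff)
    also have "\<dots> = falling (count m' b) (count D' b) * (\<Prod>a\<in>set_mset D' - {b}. falling (count m' a) (count D' a))"
      by (simp add: prod.insert_remove)
    also have "(\<Prod>a\<in>set_mset D' - {b}. falling (count m' a) (count D' a)) = C"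
      unfolding C_def using that mem by (intro prod.cong) auto
    finally show ?thesis .
  qed
  have 1: "monom_deriv x D (add_mset b m) = falling (Suc (count m b)) (count D b) * C * ?X (add_mset b m - D)"
    unfolding monom_deriv_def by (subst split) auto
  have 2: "monom_deriv x D m = falling (count m b) (count D b) * C * ?X (m - D)"
    unfolding monom_deriv_def by (subst split) auto
  have 3: "monom_deriv x (D - {#b#}) m = falling (count m b) (count D b - 1) * C * ?X (m - (D - {#b#}))"
    unfolding monom_deriv_def by (subst split) auto
  \<comment> \<open>Multiset subtraction truncates when \<open>D\<close> contains more copies of
    \<open>b\<close> than \<open>m\<close>, but the falling factorial vanishes in that case.\<close>
  have 4: "x b * (falling (count m b) (count D b) * ?X (m - D)) =
      falling (count m b) (count D b) * ?X (add_mset b m - D)"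
  proof (cases "count D b \<le> count m b")
    case True
    then have "add_mset b m - D = add_mset b (m - D)"
      by (intro multiset_eqI) (auto simp: Suc_diff_le)
    then show ?thesis by simp
  next
    case False
    then show ?thesis by (simp add: falling_eq_0)
  qed
  show ?thesis
  proof (cases "count D b")
    case 0
    then show ?thesis using 4 unfolding 1 2 3 by (simp add: ac_simps)
  next
    case (Suc d)
    then have "add_mset b m - D = m - (D - {#b#})"
      by (intro multiset_eqI) auto
    then show ?thesis using 4 Suc unfolding 1 2 3
      by (simp add: falling_Suc_Suc del: of_nat_Suc) (simp add: algebra_simps del: of_nat_Suc)
  qed
qed

text \<open>\<open>pderivs\<close> is indexed by the monomials that remain after differentiation.
  Reindexing by the original monomials exhibits the derivative as linear in the coefficients, with a
  range of summation independent of \<open>D\<close>.\<close>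

lemma evalF_pderivs:
  fixes c :: "'a multiset \<Rightarrow> 'f::comm_ring_1"
  assumes "fin_poly c"
  shows "evalF (pderivs D c) x = (\<Sum>m | c m \<noteq> 0. c m * monom_deriv x D m)"
proof -
  let ?X = "\<lambda>m. prod_mset (image_mset x m)"
  have fin: "finite {m. c m \<noteq> 0}" using assms by (simp add: fin_poly_def)
  have bij: "bij_betw (\<lambda>m. m + D) {m. c (m + D) \<noteq> 0} {m. c m \<noteq> 0 \<and> D \<subseteq># m}"
    by (rule bij_betw_byWitness[where f' = "\<lambda>m. m - D"]) auto
  have "finite {m. c m \<noteq> 0 \<and> D \<subseteq># m}" using fin by simp
  then have fin': "finite {m. c (m + D) \<noteq> 0}" using bij_betw_finite[OF bij] by simp
  have "evalF (pderivs D c) x = (\<Sum>m | c (m + D) \<noteq> 0. pderivs D c m * ?X m)"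
    unfolding evalF_def using fin' by (intro sum.mono_neutral_left) (auto simp: pderivs_def)
  also have "\<dots> = (\<Sum>m | c (m + D) \<noteq> 0. c (m + D) * monom_deriv x D (m + D))"
  proof (intro sum.cong refl)
    fix m
    have "(\<Prod>a\<in>set_mset D. pochhammer (of_nat (count m a + 1)) (count D a)) =
      (\<Prod>a\<in>set_mset D. falling (count (m + D) a) (count D a) :: 'f)"
    proof (intro prod.cong refl)
      fix a show "pochhammer (of_nat (count m a + 1)) (count D a) = (falling (count (m + D) a) (count D a) :: 'f)"
        using pochhammer_eq_falling[of "count D a" "count (m + D) a", where ?'f = 'f] by simp
    qed
    then show "pderivs D c m * ?X m = c (m + D) * monom_deriv x D (m + D)"
      by (simp add: pderivs_def monom_deriv_def ac_simps)
  qed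
  also have "\<dots> = (\<Sum>m | c m \<noteq> 0 \<and> D \<subseteq># m. c m * monom_deriv x D m)"
    by (rule sum.reindex_bij_betw[OF bij])
  also have "\<dots> = (\<Sum>m | c m \<noteq> 0. c m * monom_deriv x D m)"
    using fin by (intro sum.mono_neutral_left) (auto, metis monom_deriv_eq_0 mult_zero_right)
  finally show ?thesis .
qed

lemma pderivs_empty: "pderivs {#} c = c"
  by (simp add: pderivs_def)

section \<open>Scaling limits\<close>

locale scaled_cumulants =
  fixes sm :: "'f::real_normed_field \<Rightarrow> 'b::comm_ring_1 \<Rightarrow> 'b"
    and q :: "'a \<Rightarrow> 'b"
    and E :: "real \<Rightarrow> 'b \<Rightarrow> 'f"
    and \<kappa> :: "real \<Rightarrow> 'b list \<Rightarrow> 'f"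
  assumes cumulant_functional: "l > 0 \<Longrightarrow> cumulant_functional sm (E l) (\<kappa> l)"
    and S_exists: "as \<noteq> [] \<Longrightarrow>
        \<exists>L. ((\<lambda>l. of_real l ^ (length as - 1) * \<kappa> l (map q as)) \<longlongrightarrow> L) at_top"
begin

definition S :: "nat set \<Rightarrow> (nat \<Rightarrow> 'a) \<Rightarrow> 'f" where
  "S V f = Slim \<kappa> (map (\<lambda>k. q (f k)) (sorted_list_of_set V))"

definition mean :: "'a \<Rightarrow> 'f" where
  "mean a = Lim at_top (\<lambda>l. E l (q a))"

abbreviation monom :: "'a multiset \<Rightarrow> 'b" where
  "monom m \<equiv> prod_mset (image_mset q m)"

definition scaled :: "nat set \<Rightarrow> (nat \<Rightarrow> 'b) \<Rightarrow> real \<Rightarrow> 'f" where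
  "scaled A f l = of_real l ^ (card A - 1) * cumulant_on (\<kappa> l) A f"

lemma eventually_cumulant_functional: "\<forall>\<^sub>F l in at_top. l > 0 \<and> cumulant_functional sm (E l) (\<kappa> l)"
  using eventually_gt_at_top[of "0::real"] by eventually_elim (simp add: cumulant_functional)

lemma S_cong: "(\<And>k. k \<in> V \<Longrightarrow> f k = g k) \<Longrightarrow> S V f = S V g"
proof (cases "finite V")
  case True
  assume "\<And>k. k \<in> V \<Longrightarrow> f k = g k"
  then have "map (\<lambda>k. q (f k)) (sorted_list_of_set V) = map (\<lambda>k. q (g k)) (sorted_list_of_set V)"
    using True by (intro map_cong) auto
  then show ?thesis unfolding S_def by (rule arg_cong)
qed (simp add: S_def)

lemma scaled_generators_tendsto:
  assumes "finite A" "A \<noteq> {}"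
  shows "(scaled A (\<lambda>k. q (b k)) \<longlongrightarrow> S A b) at_top"
proof -
  let ?as = "map b (sorted_list_of_set A)"
  have ne: "?as \<noteq> []" and len: "length ?as = card A" using assms by auto
  have eq: "map q ?as = map (\<lambda>k. q (b k)) (sorted_list_of_set A)" by simp
  obtain L where L: "((\<lambda>l. of_real l ^ (length ?as - 1) * \<kappa> l (map q ?as)) \<longlongrightarrow> L) at_top"
    using S_exists[OF ne] by blast
  have L': "(scaled A (\<lambda>k. q (b k)) \<longlongrightarrow> L) at_top"
    using L unfolding len eq scaled_def cumulant_on_def .
  have "S A b = Lim at_top (scaled A (\<lambda>k. q (b k)))"
    unfolding S_def Slim_def scaled_def cumulant_on_def by simp
  also have "\<dots> = L" using L' by (intro tendsto_Lim) auto
  finally show ?thesis using L' by simp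
qed

lemma scaled_singleton: "\<forall>\<^sub>F l in at_top. scaled {n} f l = E l (f n)"
  using eventually_cumulant_functional
  by eventually_elim (auto simp: scaled_def dest: cumulant_functional.K_singleton)

lemma S_singleton: "S {n} b = mean (b n)"
proof -
  have "((\<lambda>l. E l (q (b n))) \<longlongrightarrow> S {n} b) at_top"
    using scaled_generators_tendsto[of "{n}" b] tendsto_cong[OF scaled_singleton[of n "\<lambda>k. q (b k)"]] by simp
  then show ?thesis unfolding mean_def by (intro tendsto_Lim[symmetric]) auto
qed

text \<open>The powers of \<open>l\<close> match in each product because the two index sets overlap
  in \<open>n\<close> alone: \<open>card R + (card (A - R) - 1) = card A - 1\<close>. The joint
  cumulant would need one power more, which leaves the factor \<open>1/l\<close>.\<close>

lemma scaled_mult_tendsto: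
  assumes A: "finite A" "n \<in> A" "n' \<notin> A"
    and joint: "(scaled (insert n' A) (f(n:=y, n':=z)) \<longlongrightarrow> L) at_top"
    and left: "\<And>R. R \<subseteq> A - {n} \<Longrightarrow> (scaled (insert n R) (f(n:=y)) \<longlongrightarrow> L1 R) at_top"
    and right: "\<And>R. R \<subseteq> A - {n} \<Longrightarrow> (scaled (A - R) (f(n:=z)) \<longlongrightarrow> L2 R) at_top"
  shows "(scaled A (f(n:=y*z)) \<longlongrightarrow> (\<Sum>R\<in>Pow (A - {n}). L1 R * L2 R)) at_top"
proof -
  have c: "card A \<noteq> 0" using A by auto
  have "((\<lambda>l. inverse (of_real l) * scaled (insert n' A) (f(n:=y, n':=z)) l +
     (\<Sum>R\<in>Pow (A - {n}). scaled (insert n R) (f(n:=y)) l * scaled (A - R) (f(n:=z)) l))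
     \<longlongrightarrow> 0 * L + (\<Sum>R\<in>Pow (A - {n}). L1 R * L2 R)) at_top"
  proof (intro tendsto_add tendsto_mult joint tendsto_sum)
    have "((\<lambda>l::real. of_real (inverse l) :: 'f) \<longlongrightarrow> of_real 0) at_top"
      by (intro tendsto_of_real tendsto_inverse_0_at_top filterlim_ident)
    then show "((\<lambda>l::real. inverse (of_real l) :: 'f) \<longlongrightarrow> 0) at_top" by simp
  qed (auto intro: left right)
  moreover have "\<forall>\<^sub>F l in at_top. inverse (of_real l) * scaled (insert n' A) (f(n:=y, n':=z)) l +
     (\<Sum>R\<in>Pow (A - {n}). scaled (insert n R) (f(n:=y)) l * scaled (A - R) (f(n:=z)) l) = scaled A (f(n:=y*z)) l"
    using eventually_cumulant_functional
  proof eventually_elim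
    case (elim l)
    then have l: "l > 0" and cf: "cumulant_functional sm (E l) (\<kappa> l)" by auto
    let ?K = "cumulant_on (\<kappa> l)"
    have "(of_real l :: 'f) ^ card A = of_real l * of_real l ^ (card A - 1)"
      using c by (cases "card A") auto
    then have 1: "inverse (of_real l) * scaled (insert n' A) (f(n:=y, n':=z)) l =
        of_real l ^ (card A - 1) * ?K (insert n' A) (f(n:=y, n':=z))"
      using l A by (simp add: scaled_def field_simps)
    have 2: "scaled (insert n R) (f(n:=y)) l * scaled (A - R) (f(n:=z)) l =
        of_real l ^ (card A - 1) * (?K (insert n R) (f(n:=y)) * ?K (A - R) (f(n:=z)))"
      if "R \<in> Pow (A - {n})" for R
    proof -
      have R: "R \<subseteq> A" "n \<notin> R" "finite R" "n \<in> A - R"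
        using that A finite_subset[of R "A - {n}"] by auto
      have "card (A - R) \<noteq> 0" using R A by auto
      then have "card R + (card (A - R) - 1) = card A - 1"
        using R A card_mono[of A R] by (simp add: card_Diff_subset)
      then have "(of_real l :: 'f) ^ (card A - 1) = of_real l ^ card R * of_real l ^ (card (A - R) - 1)"
        by (metis power_add)
      then show ?thesis using R by (simp add: scaled_def ac_simps)
    qed
    have "scaled A (f(n:=y*z)) l = of_real l ^ (card A - 1) * ?K (insert n' A) (f(n:=y, n':=z)) +
      (\<Sum>R\<in>Pow (A - {n}). of_real l ^ (card A - 1) * (?K (insert n R) (f(n:=y)) * ?K (A - R) (f(n:=z))))"
      unfolding scaled_def cumulant_functional.K_mult[OF cf A] by (simp only: distrib_left sum_distrib_left)
    then show ?case unfolding 1 using 2 by (simp only: cong: sum.cong)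
  qed
  ultimately show ?thesis by (rule Lim_transform_eventually[THEN tendsto_eq_rhs]) simp
qed

end

section \<open>Limits of the scaled cumulants of monomials and polynomials\<close>

locale scaled_cumulants_finite = scaled_cumulants sm q E \<kappa>
  for sm :: "'f::real_normed_field \<Rightarrow> 'b::comm_ring_1 \<Rightarrow> 'b" and q :: "'a \<Rightarrow> 'b" and E \<kappa> +
  fixes G :: "'a set"
  assumes finite_G: "finite G"
begin

sublocale hypertree_sum G S
  by unfold_locales (auto intro: S_cong finite_G)

text \<open>A monomial of degree \<open>s + 1\<close> is replaced by factors of degrees 1 and
  \<open>s\<close>, which may occur in the same cumulant. The measure decreases since
  \<open>1 + s^2 < (s + 1)^2\<close> for \<open>s \<ge> 1\<close>. The recursion ends at a constant
  argument or at generators only.\<close>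

lemma scaled_monom_tendsto:
  assumes "finite A" "A \<noteq> {}" "\<And>k. k \<in> A \<Longrightarrow> set_mset (m k) \<subseteq> G"
  shows "(scaled A (\<lambda>k. monom (m k)) \<longlongrightarrow> hsum A (\<lambda>k D. monom_deriv mean D (m k))) at_top"
  using assms
proof (induction "\<Sum>k\<in>A. (size (m k))\<^sup>2" arbitrary: A m rule: less_induct)
  case less
  note fA = less.prems(1)
  let ?f = "\<lambda>k. monom (m k)" and ?d = "\<lambda>k D. monom_deriv mean D (m k)"
  consider (empty) n where "n \<in> A" "m n = {#}"
    | (single) "\<And>k. k \<in> A \<Longrightarrow> size (m k) = 1"
    | (large) n where "n \<in> A" "size (m n) \<ge> 2"
  proof -
    have "size (m k) = 0 \<or> size (m k) = 1 \<or> size (m k) \<ge> 2" for k by linarith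
    then show thesis using that by (metis size_eq_0_iff_empty)
  qed
  then show ?case
  proof cases
    case empty
    have f: "?f = ?f(n:=1)" and d: "?d = ?d(n:=(\<lambda>D. if D = {#} then 1 else 0))"
      using empty(2) by (auto simp: monom_deriv_empty fun_eq_iff)
    show ?thesis
    proof (cases "A = {n}")
      case True
      have "\<forall>\<^sub>F l in at_top. scaled {n} ?f l = 1"
        using scaled_singleton[of n ?f] eventually_cumulant_functional
        by eventually_elim (use empty(2) in \<open>auto dest: cumulant_functional.E_one\<close>)
      moreover have "hsum {n} ?d = 1" by (simp add: hsum_singleton empty(2) monom_deriv_empty)
      ultimately show ?thesis unfolding True by (simp add: tendsto_eventually)
    next
      case False
      have "\<forall>\<^sub>F l in at_top. scaled A ?f l = 0"
        using eventually_cumulant_functional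
      proof eventually_elim
        case (elim l)
        then have "cumulant_on (\<kappa> l) A (?f(n:=1)) = 0"
          using cumulant_functional.K_one[of sm "E l" "\<kappa> l" A n ?f] fA empty False by blast
        then show ?case unfolding scaled_def f[symmetric] by simp
      qed
      moreover have "hsum A ?d = 0"
        using hsum_one[OF fA empty(1) False, of ?d] unfolding d[symmetric] .
      ultimately show ?thesis by (simp add: tendsto_eventually)
    qed
  next
    case single
    then have "\<forall>k\<in>A. \<exists>b. m k = {#b#}" by (simp add: size_1_singleton_mset)
    then obtain b where b: "\<And>k. k \<in> A \<Longrightarrow> m k = {#b k#}" by metis
    have f: "scaled A ?f = scaled A (\<lambda>k. q (b k))"
    proof
      fix l show "scaled A ?f l = scaled A (\<lambda>k. q (b k)) l"
        using b fA unfolding scaled_def cumulant_on_def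
        by (intro arg_cong2[where f="(*)"] refl arg_cong[of _ _ "\<kappa> l"] map_cong) auto
    qed
    have "hsum A ?d = hsum A (\<lambda>k. generator_derivs (b k) (mean (b k)))"
      using b by (intro hsum_cong) (auto simp: monom_deriv_generator)
    also have "\<dots> = S A b"
    \<comment> \<open>A single vertex carries no patch, so there the sum is the undifferentiated
      value \<open>mean (b k)\<close>, which is also the first cumulant limit.\<close>
    proof (cases "\<exists>k. A = {k}")
      case True
      then show ?thesis by (auto simp: hsum_singleton generator_derivs_def S_singleton)
    next
      case False
      have "b k \<in> G" if "k \<in> A" for k using b[OF that] less.prems(3)[OF that] by auto
      then show ?thesis using False less.prems by (intro hsum_generators) auto
    qed
    finally show ?thesis unfolding f using scaled_generators_tendsto less.prems by simp
  next
    case large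
    then obtain b m' where m: "m n = add_mset b m'" by (cases "m n") auto
    have s: "size m' \<ge> 1" using large m by simp
    obtain n' where n': "n' \<notin> A" using ex_new_if_finite[OF infinite_UNIV_nat fA] by blast
    have nn: "n' \<noteq> n" using n' large by auto
    define rest where "rest = (\<Sum>k\<in>A-{n}. (size (m k))\<^sup>2)"
    have \<mu>: "(\<Sum>k\<in>A. (size (m k))\<^sup>2) = (size m' + 1)\<^sup>2 + rest"
      using fA large(1) m by (subst sum.remove[of A n]) (auto simp: rest_def)
    have bG: "b \<in> G" "set_mset m' \<subseteq> G" using less.prems(3)[OF large(1)] m by auto
    have f: "?f = ?f(n := q b * monom m')" using m by (auto simp: fun_eq_iff)
    have d: "?d = ?d(n := (\<lambda>D. mean b * monom_deriv mean D m' + of_nat (count D b) * monom_deriv mean (D - {#b#}) m'))"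
      using m by (auto simp: fun_eq_iff monom_deriv_add_mset)
    have joint: "(scaled (insert n' A) (?f(n:=q b, n':=monom m')) \<longlongrightarrow>
        hsum (insert n' A) (\<lambda>k D. monom_deriv mean D ((m(n:={#b#}, n':=m')) k))) at_top"
    proof -
      have *: "?f(n:=q b, n':=monom m') = (\<lambda>k. monom ((m(n:={#b#}, n':=m')) k))" by (auto simp: fun_eq_iff)
      have "(\<Sum>k\<in>A-{n}. (size ((m(n:={#b#}, n':=m')) k))\<^sup>2) = rest"
        unfolding rest_def using n' by (intro sum.cong) auto
      then have "(\<Sum>k\<in>insert n' A. (size ((m(n:={#b#}, n':=m')) k))\<^sup>2) = (size m')\<^sup>2 + (1 + rest)"
        using fA n' nn large(1) by (simp add: sum.remove[of A n])
      then have "(\<Sum>k\<in>insert n' A. (size ((m(n:={#b#}, n':=m')) k))\<^sup>2) < (\<Sum>k\<in>A. (size (m k))\<^sup>2)"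
        using s unfolding \<mu> by (simp add: power2_eq_square)
      then show ?thesis unfolding * by (rule less.hyps) (use fA less.prems(3) bG in auto)
    qed
    have left: "(scaled (insert n R) (?f(n:=q b)) \<longlongrightarrow> hsum (insert n R) (?d(n:=generator_derivs b (mean b)))) at_top"
      if R: "R \<subseteq> A - {n}" for R
    proof -
      have *: "?f(n:=q b) = (\<lambda>k. monom ((m(n:={#b#})) k))" by (auto simp: fun_eq_iff)
      have **: "?d(n:=generator_derivs b (mean b)) = (\<lambda>k D. monom_deriv mean D ((m(n:={#b#})) k))"
        by (auto simp: fun_eq_iff monom_deriv_generator)
      have fR: "finite R" using R fA finite_subset by auto
      have "(\<Sum>k\<in>R. (size ((m(n:={#b#})) k))\<^sup>2) = (\<Sum>k\<in>R. (size (m k))\<^sup>2)"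
        using R by (intro sum.cong) auto
      also have "\<dots> \<le> rest" unfolding rest_def using R fA by (intro sum_mono2) auto
      finally have "(\<Sum>k\<in>insert n R. (size ((m(n:={#b#})) k))\<^sup>2) \<le> 1 + rest"
        using fR R by (subst sum.insert) auto
      then have "(\<Sum>k\<in>insert n R. (size ((m(n:={#b#})) k))\<^sup>2) < (\<Sum>k\<in>A. (size (m k))\<^sup>2)"
        using s unfolding \<mu> by (simp add: power2_eq_square)
      then show ?thesis unfolding * ** by (rule less.hyps) (use fR R less.prems(3) bG in auto)
    qed
    have right: "(scaled (A - R) (?f(n:=monom m')) \<longlongrightarrow> hsum (A - R) (?d(n:=(\<lambda>D. monom_deriv mean D m')))) at_top"
      if R: "R \<subseteq> A - {n}" for R
    proof -
      have *: "?f(n:=monom m') = (\<lambda>k. monom ((m(n:=m')) k))" by (auto simp: fun_eq_iff)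
      have **: "?d(n:=(\<lambda>D. monom_deriv mean D m')) = (\<lambda>k D. monom_deriv mean D ((m(n:=m')) k))"
        by (auto simp: fun_eq_iff)
      have nR: "n \<in> A - R" using R large by auto
      have "(\<Sum>k\<in>A - R - {n}. (size ((m(n:=m')) k))\<^sup>2) = (\<Sum>k\<in>A - R - {n}. (size (m k))\<^sup>2)"
        by (intro sum.cong) auto
      also have "\<dots> \<le> rest" unfolding rest_def using fA by (intro sum_mono2) auto
      finally have "(\<Sum>k\<in>A - R. (size ((m(n:=m')) k))\<^sup>2) \<le> (size m')\<^sup>2 + rest"
        using fA nR by (subst sum.remove[of _ n]) auto
      then have "(\<Sum>k\<in>A - R. (size ((m(n:=m')) k))\<^sup>2) < (\<Sum>k\<in>A. (size (m k))\<^sup>2)"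
        using s unfolding \<mu> by (simp add: power2_eq_square)
      then show ?thesis unfolding * ** by (rule less.hyps) (use fA nR less.prems(3) bG in auto)
    qed
    have "(scaled A (?f(n := q b * monom m')) \<longlongrightarrow> (\<Sum>R\<in>Pow (A - {n}).
       hsum (insert n R) (?d(n:=generator_derivs b (mean b))) * hsum (A - R) (?d(n:=(\<lambda>D. monom_deriv mean D m'))))) at_top"
      by (rule scaled_mult_tendsto[OF fA large(1) n' joint left right])
    then show ?thesis
      using hsum_mult[OF fA large(1), of ?d "mean b" "\<lambda>D. monom_deriv mean D m'" b]
      unfolding f[symmetric] d[symmetric] by (simp only:)
  qed
qed

text \<open>Both sides are linear in each argument, so monomials are exchanged for polynomials one
  index at a time; \<open>B\<close> collects the indices already exchanged. The family
  \<open>m\<close> stays arbitrary because expanding the polynomial at \<open>n\<close> inserts each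
  of its monomials there.\<close>

lemma scaled_poly_tendsto:
  assumes "finite A" "A \<noteq> {}" "\<And>k. k \<in> A \<Longrightarrow> fin_poly (c k)"
    and vars: "\<And>k p. k \<in> A \<Longrightarrow> c k p \<noteq> 0 \<Longrightarrow> set_mset p \<subseteq> G"
  shows "(scaled A (\<lambda>k. evalA sm q (c k)) \<longlongrightarrow> hsum A (\<lambda>k D. evalF (pderivs D (c k)) mean)) at_top"
proof -
  define f where "f B m k = (if k \<in> B then evalA sm q (c k) else monom (m k))" for B m k
  define d where "d B m k D = (if k \<in> B then evalF (pderivs D (c k)) mean else monom_deriv mean D (m k))" for B m k D
  have "(scaled A (f B m) \<longlongrightarrow> hsum A (d B m)) at_top"
    if "finite B" "B \<subseteq> A" "\<And>k. k \<in> A \<Longrightarrow> set_mset (m k) \<subseteq> G" for B m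
    using that
  proof (induction B arbitrary: m rule: finite_induct)
    case empty
    then show ?case using scaled_monom_tendsto[OF assms(1,2), of m] by (simp add: f_def d_def)
  next
    case (insert n B)
    have n: "n \<in> A" using insert by auto
    let ?M = "{p. c n p \<noteq> 0}"
    have fM: "finite ?M" using assms(3)[OF n] by (simp add: fin_poly_def)
    have f_upd: "f (insert n B) m = (f B m)(n := \<Sum>p\<in>?M. sm (c n p) (monom p))"
      using insert.hyps by (auto simp: f_def fun_eq_iff evalA_def)
    have d_upd: "d (insert n B) m = (d B m)(n := (\<lambda>D. \<Sum>p\<in>?M. c n p * monom_deriv mean D p))"
      using insert.hyps assms(3)[OF n] by (auto simp: d_def fun_eq_iff evalF_pderivs)
    have f_p: "(f B m)(n := monom p) = f B (m(n:=p))" for p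
      using insert.hyps by (auto simp: f_def fun_eq_iff)
    have d_p: "(d B m)(n := (\<lambda>D. monom_deriv mean D p)) = d B (m(n:=p))" for p
      using insert.hyps by (auto simp: d_def fun_eq_iff)
    have "((\<lambda>l. \<Sum>p\<in>?M. c n p * scaled A (f B (m(n:=p))) l) \<longlongrightarrow>
        (\<Sum>p\<in>?M. c n p * hsum A (d B (m(n:=p))))) at_top"
      by (intro tendsto_sum tendsto_mult_left insert.IH) (use insert.prems vars[OF n] in auto)
    moreover have "\<forall>\<^sub>F l in at_top. (\<Sum>p\<in>?M. c n p * scaled A (f B (m(n:=p))) l) = scaled A (f (insert n B) m) l"
      using eventually_cumulant_functional
    proof eventually_elim
      case (elim l)
      then have cf: "cumulant_functional sm (E l) (\<kappa> l)" by simp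
      show ?case
        unfolding scaled_def f_upd cumulant_functional.K_sum[OF cf assms(1) n fM] f_p sum_distrib_left
        by (intro sum.cong refl) (simp only: ac_simps)
    qed
    ultimately have "(scaled A (f (insert n B) m) \<longlongrightarrow> (\<Sum>p\<in>?M. c n p * hsum A (d B (m(n:=p))))) at_top"
      by (rule Lim_transform_eventually)
    also have "(\<Sum>p\<in>?M. c n p * hsum A (d B (m(n:=p)))) = hsum A (d (insert n B) m)"
      unfolding d_upd hsum_linear[OF assms(1) n] d_p ..
    finally show ?case .
  qed
  \<comment> \<open>Once all indices are exchanged the monomials no longer matter, and
    \<open>{#}\<close> is a mere default.\<close>
  from this[OF assms(1) order_refl, of "\<lambda>_. {#}"]
  have lim: "(scaled A (f A (\<lambda>_. {#})) \<longlongrightarrow> hsum A (d A (\<lambda>_. {#}))) at_top" by simp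
  have "scaled A (f A (\<lambda>_. {#})) = scaled A (\<lambda>k. evalA sm q (c k))"
  proof
    fix l show "scaled A (f A (\<lambda>_. {#})) l = scaled A (\<lambda>k. evalA sm q (c k)) l"
      using assms(1) unfolding scaled_def cumulant_on_def
      by (intro arg_cong2[where f="(*)"] refl arg_cong[of _ _ "\<kappa> l"] map_cong) (auto simp: f_def)
  qed
  moreover have "hsum A (d A (\<lambda>_. {#})) = hsum A (\<lambda>k D. evalF (pderivs D (c k)) mean)"
    by (intro hsum_cong) (simp add: d_def)
  ultimately show ?thesis using lim by simp
qed

end

section \<open>Return from the finite label set to all labels\<close>

context scaled_cumulants
begin

lemma cumulant_poly_tendsto:
  assumes "Ps \<noteq> []" "\<forall>c\<in>set Ps. fin_poly c"
    and G: "finite G" "\<And>c p. c \<in> set Ps \<Longrightarrow> c p \<noteq> 0 \<Longrightarrow> set_mset p \<subseteq> G"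
  shows "((\<lambda>l. of_real l ^ (length Ps - 1) * \<kappa> l (map (evalA sm q) Ps)) \<longlongrightarrow>
    hypertree_sum.hsum G S {0..<length Ps} (\<lambda>k D. evalF (pderivs D (Ps ! k)) mean)) at_top"
proof -
  interpret scaled_cumulants_finite sm q E \<kappa> G by unfold_locales (rule G)
  have "map (\<lambda>k. evalA sm q (Ps ! k)) [0..<length Ps] = map (evalA sm q) Ps"
    by (intro nth_equalityI) auto
  then have "scaled {0..<length Ps} (\<lambda>k. evalA sm q (Ps ! k)) =
      (\<lambda>l. of_real l ^ (length Ps - 1) * \<kappa> l (map (evalA sm q) Ps))"
    by (simp add: scaled_def cumulant_on_def fun_eq_iff)
  moreover have "(scaled {0..<length Ps} (\<lambda>k. evalA sm q (Ps ! k)) \<longlongrightarrow>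
      hsum {0..<length Ps} (\<lambda>k D. evalF (pderivs D (Ps ! k)) mean)) at_top"
    using assms(1,2) by (intro scaled_poly_tendsto G(2)) auto
  ultimately show ?thesis by simp
qed

text \<open>The first cumulant is the expectation, and the only hypertree on a point is edgeless, so
  the polynomial is evaluated without differentiation.\<close>

lemma moment_poly_tendsto:
  assumes "fin_poly c"
  shows "((\<lambda>l. E l (evalA sm q c)) \<longlongrightarrow> evalF c mean) at_top"
proof -
  define G where "G = (\<Union>p\<in>{p. c p \<noteq> 0}. set_mset p)"
  interpret scaled_cumulants_finite sm q E \<kappa> G
    by unfold_locales (use assms in \<open>auto simp: G_def fin_poly_def\<close>)
  have "(scaled {0} (\<lambda>k. evalA sm q c) \<longlongrightarrow> hsum {0} (\<lambda>k D. evalF (pderivs D c) mean)) at_top"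
    using assms by (intro scaled_poly_tendsto) (auto simp: G_def)
  then show ?thesis
    using tendsto_cong[OF scaled_singleton[of 0 "\<lambda>_. evalA sm q c"]]
    by (simp add: hsum_singleton pderivs_empty)
qed

text \<open>A label outside \<open>G\<close> at an incidence \<open>(V, k)\<close> differentiates
  the \<open>k\<close>-th polynomial by a variable that does not occur in it. The summand vanishes,
  so the unrestricted sum has finite support.\<close>

lemma infsum_labellings:
  assumes "finite G" "U \<in> hypertrees {0..<length Ps}" "\<forall>c\<in>set Ps. fin_poly c"
    and G: "\<And>c p. c \<in> set Ps \<Longrightarrow> c p \<noteq> 0 \<Longrightarrow> set_mset p \<subseteq> G"
  shows "infsum (\<lambda>a. w a * (\<Prod>k<length Ps. evalF (pderivs (vertex_labels U a k) (Ps ! k)) y))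
      (Pi\<^sub>E (Sigma U (\<lambda>V. V)) (\<lambda>_. UNIV)) =
    (\<Sum>a\<in>Pi\<^sub>E (Sigma U (\<lambda>V. V)) (\<lambda>_. G). w a * (\<Prod>k<length Ps. evalF (pderivs (vertex_labels U a k) (Ps ! k)) y))"
proof -
  let ?h = "\<lambda>a. w a * (\<Prod>k<length Ps. evalF (pderivs (vertex_labels U a k) (Ps ! k)) y)"
  let ?I = "Sigma U (\<lambda>V. V)"
  have fU: "finite U" using finite_hypertrees(2)[OF _ assms(2)] by simp
  have sub: "V \<subseteq> {0..<length Ps}" if "V \<in> U" for V using hypertreesD(1)[OF assms(2) that] .
  have fin: "finite (Pi\<^sub>E ?I (\<lambda>_. G))"
    using fU sub assms(1) finite_subset by (intro finite_PiE finite_SigmaI) blast+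
  have "infsum ?h (Pi\<^sub>E ?I (\<lambda>_. UNIV)) = infsum ?h (Pi\<^sub>E ?I (\<lambda>_. G))"
  proof (rule infsum_cong_neutral)
    fix a assume a: "a \<in> Pi\<^sub>E ?I (\<lambda>_. UNIV) - Pi\<^sub>E ?I (\<lambda>_. G)"
    then obtain V k where Vk: "V \<in> U" "k \<in> V" "a (V, k) \<notin> G" by (auto simp: PiE_def Pi_def)
    have k: "k < length Ps" using sub[OF Vk(1)] Vk(2) by auto
    have mem: "a (V, k) \<in># vertex_labels U a k"
      using Vk fU by (auto simp: vertex_labels_def)
    have "evalF (pderivs (vertex_labels U a k) (Ps ! k)) y = 0"
    proof (subst evalF_pderivs)
      show "fin_poly (Ps ! k)" using assms(3) k by simp
      have "\<not> vertex_labels U a k \<subseteq># p" if "(Ps ! k) p \<noteq> 0" for p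
        using G[of "Ps ! k" p] k that Vk mem by (meson mset_subset_eqD nth_mem subsetD)
      then show "(\<Sum>p | (Ps ! k) p \<noteq> 0. (Ps ! k) p * monom_deriv y (vertex_labels U a k) p) = 0"
        by (intro sum.neutral) (auto simp: monom_deriv_eq_0)
    qed
    then have "(\<Prod>k<length Ps. evalF (pderivs (vertex_labels U a k) (Ps ! k)) y) = 0"
      using k by (intro prod_zero) auto
    then show "?h a = 0" by simp
  qed auto
  then show ?thesis using fin by simp
qed

end

theorem theorem1:
  fixes sm :: "'f::real_normed_field \<Rightarrow> 'b::comm_ring_1 \<Rightarrow> 'b"
    and q :: "'a \<Rightarrow> 'b"
    and E :: "real \<Rightarrow> 'b \<Rightarrow> 'f"
    and \<kappa> :: "real \<Rightarrow> 'b list \<Rightarrow> 'f"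
  assumes alg: "F_algebra sm"
    and gen: "\<forall>x. \<exists>c. fin_poly c \<and> x = evalA sm q c"
    and E_add: "\<forall>l>0. \<forall>x y. E l (x + y) = E l x + E l y"
    and E_smult: "\<forall>l>0. \<forall>a x. E l (sm a x) = a * E l x"
    and E_one: "\<forall>l>0. E l 1 = 1"
    and cumulants: "\<forall>l>0. \<forall>os. os \<noteq> [] \<longrightarrow>
        E l (prod_list os) =
          (\<Sum>P\<in>set_partitions (length os). \<Prod>V\<in>P. \<kappa> l (map (\<lambda>j. os ! j) (sorted_list_of_set V)))"
    and S_exists: "\<forall>as. as \<noteq> [] \<longrightarrow>
        (\<exists>L. ((\<lambda>l. of_real l ^ (length as - 1) * \<kappa> l (map q as)) \<longlongrightarrow> L) at_top)"
  shows
    "(\<forall>Ps. Ps \<noteq> [] \<and> (\<forall>c\<in>set Ps. fin_poly c) \<longrightarrow>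
        (\<exists>L. ((\<lambda>l. of_real l ^ (length Ps - 1) * \<kappa> l (map (evalA sm q) Ps)) \<longlongrightarrow> L) at_top))
   \<and> (\<forall>c. fin_poly c \<longrightarrow>
        ((\<lambda>l. E l (evalA sm q c)) \<longlongrightarrow> evalF c (\<lambda>a. Lim at_top (\<lambda>l. E l (q a)))) at_top)
   \<and> (\<forall>Ps. 2 \<le> length Ps \<and> (\<forall>c\<in>set Ps. fin_poly c) \<longrightarrow>
        Slim \<kappa> (map (evalA sm q) Ps) =
          (\<Sum>U\<in>Cmin (length Ps).
             infsum (\<lambda>a.
                 (\<Prod>V\<in>U. Slim \<kappa> (map (\<lambda>k. q (a (V, k))) (sorted_list_of_set V)))
               * (\<Prod>k<length Ps.
                    evalF (pderivs (image_mset (\<lambda>V. a (V, k)) (mset_set {V\<in>U. k \<in> V})) (Ps ! k))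
                          (\<lambda>b. Lim at_top (\<lambda>l. E l (q b)))))
               (Pi\<^sub>E (Sigma U (\<lambda>V. V)) (\<lambda>_. UNIV))))"
proof -
  interpret scaled_cumulants sm q E \<kappa>
  proof (rule scaled_cumulants.intro)
    fix l :: real assume "l > 0"
    then show "cumulant_functional sm (E l) (\<kappa> l)"
      using alg E_add E_smult E_one cumulants by (intro cumulant_functional.intro) auto
  qed (use S_exists in auto)
  have mean: "(\<lambda>a. Lim at_top (\<lambda>l. E l (q a))) = mean" by (simp add: mean_def fun_eq_iff)
  \<comment> \<open>All variables that occur in the given polynomials; this is the finite label
    set.\<close>
  define vars where "vars Ps = (\<Union>c\<in>set Ps. \<Union>p\<in>{p. c p \<noteq> 0}. set_mset p)"
    for Ps :: "('a multiset \<Rightarrow> 'f) list"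
  have vars: "finite (vars Ps)" if "\<forall>c\<in>set Ps. fin_poly c" for Ps
    using that by (auto simp: vars_def fin_poly_def)
  have vars': "set_mset p \<subseteq> vars Ps" if "c \<in> set Ps" "c p \<noteq> 0" for Ps c p
    using that by (auto simp: vars_def)
  have lim: "((\<lambda>l. of_real l ^ (length Ps - 1) * \<kappa> l (map (evalA sm q) Ps)) \<longlongrightarrow>
    hypertree_sum.hsum (vars Ps) S {0..<length Ps} (\<lambda>k D. evalF (pderivs D (Ps ! k)) mean)) at_top"
    if "Ps \<noteq> []" "\<forall>c\<in>set Ps. fin_poly c" for Ps
    using that(1) that(2) vars[OF that(2)] vars' by (rule cumulant_poly_tendsto)
  show ?thesis
  proof (intro conjI allI impI)
    fix Ps :: "('a multiset \<Rightarrow> 'f) list" assume "Ps \<noteq> [] \<and> (\<forall>c\<in>set Ps. fin_poly c)"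
    then show "\<exists>L. ((\<lambda>l. of_real l ^ (length Ps - 1) * \<kappa> l (map (evalA sm q) Ps)) \<longlongrightarrow> L) at_top"
      using lim[of Ps] by blast
  next
    fix c :: "'a multiset \<Rightarrow> 'f" assume "fin_poly c"
    then show "((\<lambda>l. E l (evalA sm q c)) \<longlongrightarrow> evalF c (\<lambda>a. Lim at_top (\<lambda>l. E l (q a)))) at_top"
      unfolding mean by (rule moment_poly_tendsto)
  next
    fix Ps :: "('a multiset \<Rightarrow> 'f) list" assume Ps: "2 \<le> length Ps \<and> (\<forall>c\<in>set Ps. fin_poly c)"
    then have ne: "Ps \<noteq> []" and fin: "\<forall>c\<in>set Ps. fin_poly c" by auto
    let ?G = "vars Ps"
    interpret scaled_cumulants_finite sm q E \<kappa> ?G by unfold_locales (rule vars[OF fin])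
    have "Slim \<kappa> (map (evalA sm q) Ps) = hsum {0..<length Ps} (\<lambda>k D. evalF (pderivs D (Ps ! k)) mean)"
      unfolding Slim_def length_map by (rule tendsto_Lim[OF _ lim[OF ne fin]]) simp
    also have "\<dots> = (\<Sum>U\<in>hypertrees {0..<length Ps}. infsum (\<lambda>a. edge_weight U a *
      (\<Prod>k<length Ps. evalF (pderivs (vertex_labels U a k) (Ps ! k)) mean)) (Pi\<^sub>E (Sigma U (\<lambda>V. V)) (\<lambda>_. UNIV)))"
      unfolding hsum_def atLeast0LessThan
      by (intro sum.cong refl infsum_labellings[symmetric] vars fin vars') (auto simp: atLeast0LessThan)
    also have "hypertrees {0..<length Ps} = Cmin (length Ps)"
      using Ps by (simp add: Cmin_eq_hypertrees)
    finally show "Slim \<kappa> (map (evalA sm q) Ps) =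
          (\<Sum>U\<in>Cmin (length Ps).
             infsum (\<lambda>a.
                 (\<Prod>V\<in>U. Slim \<kappa> (map (\<lambda>k. q (a (V, k))) (sorted_list_of_set V)))
               * (\<Prod>k<length Ps.
                    evalF (pderivs (image_mset (\<lambda>V. a (V, k)) (mset_set {V\<in>U. k \<in> V})) (Ps ! k))
                          (\<lambda>b. Lim at_top (\<lambda>l. E l (q b)))))
               (Pi\<^sub>E (Sigma U (\<lambda>V. V)) (\<lambda>_. UNIV)))"
      unfolding mean edge_weight_def vertex_labels_def unfolding S_def .
  qed
qed

end
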